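(* Let $X\subset\mathbb{R}^n$ be closed, bounded and convex. Let $F(x)=\mathbb{E}[\Phi(x,\xi)]$ be monotone and continuous on $X^\epsilon$, suppose there is $C>0$ with $\mathbb{E}[\|\Phi(x,\xi)\|^2]\le C^2$ for all $x\in X^\epsilon$, and suppose the solution set $X^*$ of VI$(X,F)$ is nonempty. Let $\xi_0,\xi_1,\dots$ be i.i.d. copies of $\xi$, let $z_0,z_1,\dots$ be independent with $z_k$ uniformly distributed on $B_n(0,\epsilon_k)$, and let $x_0$, $(\xi_j)_{j\ge0}$, $(z_i)_{i\ge0}$ be mutually independent. Suppose the sequences $\{\gamma_k\},\{\eta_k\},\{\epsilon_k\}$ satisfy: (a) they are positive and converge to $0$; (b) there is $K_1\ge0$ such that $\frac{\gamma_k}{\eta_k\epsilon_k^2}\le \frac12\left(\frac{(n-1)!!}{n!!\,\kappa C}\right)^2$ for all $k\ge K_1$; (c) $\epsilon_k\le\epsilon$ for all $k\ge 0$; (d) $\sum_{k=0}^\infty\gamma_k\eta_k=\infty$; (e) $\sum_{k=0}^\infty\gamma_k^2<\infty$; (f) $\sum_{k=1}^\infty\frac{1}{\eta_{k-1}^2\eta_k\gamma_k}\left(1-\frac{\min\{\epsilon_k,\epsilon_{k-1}\}}{\max\{\epsilon_k,\epsilon_{k-1}\}}\right)^2<\infty$; (g) $\sum_{k=1}^\infty\frac{1}{\eta_k\gamma_k}\left(1-\frac{\eta_k}{\eta_{k-1}}\right)^2<\infty$; (h) $\lim_{k\to\infty}\frac{\gamma_k}{\eta_k}=0$; (i) $\lim_{k\to\infty}\frac{1}{\eta_k^2\gamma_k}\left(1-\frac{\min\{\epsilon_k,\epsilon_{k-1}\}}{\max\{\epsilon_k,\epsilon_{k-1}\}}\right)=0$;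 (j) $\lim_{k\to\infty}\frac{1}{\eta_k\gamma_k}\left|1-\frac{\eta_k}{\eta_{k-1}}\right|=0$. Let $\{x_k\}$ be generated by the RSSA scheme and let $s_k$ denote the unique solution of VI$(X,F_k+\eta_k\mathbf{I})$. Then the following hold almost surely: (1) $\lim_{k\to\infty}\|x_{k+1}-s_k\|=0$, and every accumulation point of $\{x_k\}$ is a solution of VI$(X,F)$. (2) Let $t^*$ be the smallest-norm solution of VI$(X,F)$. If $\lim_{k\to\infty}\frac{\epsilon_k}{\eta_k}=0$ and $F$ is differentiable at $t^*$ with a bounded Jacobian in a neighborhood of $t^*$, then $\{x_k\}$ converges to $t^*$.
   Context: $\|\cdot\|$ is the Euclidean norm, $B_n(y,\rho)=\{x\in\mathbb{R}^n:\|x-y\|\le\rho\}$, $\Pi_X$ is Euclidean projection onto $X$. $\epsilon>0$ is fixed and $X^\epsilon=X+B_n(0,\epsilon)$. $\xi$ is an $\mathbb{R}^d$-valued random vector, $\Phi:X^\epsilon\times\mathbb{R}^d\to\mathbb{R}^n$. For a map $H:X\to\mathbb{R}^n$, VI$(X,H)$ asks for $x^*\in X$ with $H(x^* )^T(x-x^* )\ge0$ for all $x\in X$; $X^*$ is the solution set of VI$(X,F)$. $\mathbf{I}$ is the identity map. RSSA scheme: $x_0\in X$ is a random vector with $\mathbb{E}[\|x_0\|^2]<\infty$ and $x_{k+1}=\Pi_X\big(x_k-\gamma_k(\Phi(x_k+z_k,\xi_k)+\eta_kx_k)\big)$ for $k\ge0$, where $\gamma_k$ is the stepsize, $\eta_k$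 the regularization parameter and $\epsilon_k$ the smoothing parameter. Smoothed mapping: $F_k(x)=\mathbb{E}[F(x+z_k)]$ for $x\in X$, with $z_k$ uniform on $B_n(0,\epsilon_k)$. ($F_k$ is monotone on $X$, so VI$(X,F_k+\eta_k\mathbf{I})$ has a unique solution $s_k$.) $m!!$ is the double factorial ($0!!=1$); $\kappa=1$ if $n$ is odd and $\kappa=2/\pi$ if $n$ is even. *)

theory Defs
  imports "HOL-Probability.Probability"
begin

fun dfact :: "nat \<Rightarrow> nat" where
  "dfact 0 = 1"
| "dfact (Suc 0) = 1"
| "dfact (Suc (Suc n)) = Suc (Suc n) * dfact n"

definition kappa :: "nat \<Rightarrow> real" where
  "kappa n = (if odd n then 1 else 2 / pi)"

definition enlargement :: "'a::real_normed_vector set \<Rightarrow> real \<Rightarrow> 'a set" where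
  "enlargement X e = {x + z |x z. x \<in> X \<and> z \<in> cball 0 e}"

definition monotone_map_on :: "'a::real_inner set \<Rightarrow> ('a \<Rightarrow> 'a) \<Rightarrow> bool" where
  "monotone_map_on S H \<longleftrightarrow> (\<forall>x\<in>S. \<forall>y\<in>S. (H x - H y) \<bullet> (x - y) \<ge> 0)"

definition VI_solutions :: "'a::real_inner set \<Rightarrow> ('a \<Rightarrow> 'a) \<Rightarrow> 'a set" where
  "VI_solutions X H = {s \<in> X. \<forall>x\<in>X. H s \<bullet> (x - s) \<ge> 0}"

(* x \<mapsto> E[Phi(x, xi)] is only specified on the domain S of Phi (in its first argument).
   The value 0 off S keeps composites such as F(x + z) measurable
   when z leaves its ball on a null set. *)
definition mean_map ::
  "'w measure \<Rightarrow> ('w \<Rightarrow> 'b) \<Rightarrow> 'a set \<Rightarrow> ('a \<Rightarrow> 'b \<Rightarrow> 'a::euclidean_space) \<Rightarrow> 'a \<Rightarrow> 'a" where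
  "mean_map M \<xi> S \<Phi> x = (if x \<in> S then \<integral>\<omega>. \<Phi> x (\<xi> \<omega>) \<partial>M else 0)"

definition smoothed_map ::
  "'w measure \<Rightarrow> ('w \<Rightarrow> 'a) \<Rightarrow> ('a \<Rightarrow> 'a) \<Rightarrow> 'a::euclidean_space \<Rightarrow> 'a" where
  "smoothed_map M z F x = (\<integral>\<omega>. F (x + z \<omega>) \<partial>M)"

(* The library's indep_vars needs a common value type for the whole family; here x0 and z
   take values in 'a and xi in 'b, hence the detour through the generated events. *)
datatype rv_index = Init | Sample nat | Perturb nat

definition gen_events :: "'w measure \<Rightarrow> ('w \<Rightarrow> 'a::topological_space) \<Rightarrow> 'w set set" where
  "gen_events M Y = {Y -` A \<inter> space M |A. A \<in> sets borel}"

definition mutually_independent ::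
  "'w measure \<Rightarrow> ('w \<Rightarrow> 'a::topological_space) \<Rightarrow> (nat \<Rightarrow> 'w \<Rightarrow> 'b::topological_space)
    \<Rightarrow> (nat \<Rightarrow> 'w \<Rightarrow> 'a) \<Rightarrow> bool" where
  "mutually_independent M x0 \<xi> z \<longleftrightarrow>
     prob_space.indep_sets M
       (\<lambda>i. case i of Init \<Rightarrow> gen_events M x0
                     | Sample j \<Rightarrow> gen_events M (\<xi> j)
                     | Perturb j \<Rightarrow> gen_events M (z j)) UNIV"

end

theory Submission
  imports Defs
begin

text \<open>By monotonicity of the smoothed mappings and the projection inequality, the tracking error
  \<open>V k = |x (k+1) - s k|^2\<close> satisfies
  \<open>E[V (k+1); A] \<le> (1 - u) E[V k; A] + \<beta> P(A)\<close> for every past event \<open>A\<close>, where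
  \<open>u = \<gamma> \<eta>\<close> and \<open>\<beta>\<close> collects \<open>\<gamma>^2\<close> times a second moment and \<open>|s (k+1) - s k|^2 / u\<close>. The drift
  of \<open>s\<close> is controlled by \<open>|1 - \<eta>'/\<eta>|\<close> and by the total variation distance of two uniform
  distributions on concentric balls, divided by \<open>\<eta>\<close>; so \<open>\<beta>\<close> is summable. Since \<open>u\<close> is not
  summable, \<open>E[V k]\<close> tends to 0, and the maximal inequality upgrades this to almost sure
  convergence. The rest is deterministic: limit points of \<open>s\<close> solve the limiting inequality, and
  comparing \<open>s k\<close> with the least-norm solution \<open>t\<close> gives \<open>s k \<bullet> (s k - t) \<le> O(\<epsilon>s k / \<eta> k)\<close>,
  which singles out \<open>t\<close>.\<close>

text \<open>No conditional expectation is formed: a statement about means given the past is a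
  relation between integrals over every event \<open>A\<close> of the past, and independence enters
  by drawing the current noise afresh in an inner integral. The factor \<open>1 - u\<close> comes
  from two competing effects. Strong monotonicity of modulus \<eta> contracts by
  \<open>1 - 2 * u\<close>, while replacing the target \<open>s k\<close> by
  \<open>s (Suc k)\<close> costs a factor \<open>1 + u\<close> through Young's inequality; the
  product is still at most \<open>1 - u\<close>. The weight \<open>u\<close> in that inequality is
  also what puts \<open>u\<close> under the squared drift. As \<open>F\<close> is merely continuous,
  it is bounded on a compact set but need not be Lipschitz there. A change of the smoothing radius
  is therefore measured by how much the two balls overlap and not by how far points move. A change
  of size \<open>d\<close> in the mapping moves the solution by at most \<open>d / \<eta>\<close>;
  squaring this and dividing by \<open>\<gamma> * \<eta>\<close> produces the summands of (f), and
  the change of \<eta> likewise those of (g).\<close>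

section \<open>Variational inequalities\<close>

text \<open>A fixed point of the projection of \<open>x - H x\<close> onto \<open>X\<close> solves
  the inequality, by the obtuse angle property of the projection; Brouwer's theorem supplies
  one.\<close>

lemma VI_solutions_nonempty:
  fixes H :: "'a::euclidean_space \<Rightarrow> 'a"
  assumes "compact X" "convex X" "X \<noteq> {}" and cont: "continuous_on X H"
  shows "VI_solutions X H \<noteq> {}"
proof -
  note cl = compact_imp_closed[OF assms(1)]
  have "continuous_on X (closest_point X \<circ> (\<lambda>x. x - H x))"
    by (intro continuous_on_compose continuous_intros cont
        continuous_on_closest_point[OF assms(2) cl assms(3)])
  moreover have "closest_point X \<circ> (\<lambda>x. x - H x) \<in> X \<rightarrow> X"
    using closest_point_in_set[OF cl assms(3)] by simp
  ultimately obtain y where y: "y \<in> X" "closest_point X (y - H y) = y"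
    using brouwer[OF assms(1,2,3), of "closest_point X \<circ> (\<lambda>x. x - H x)"] by auto
  have "H y \<bullet> (w - y) \<ge> 0" if "w \<in> X" for w
    using closest_point_dot[OF assms(2) cl that, of "y - H y"] y(2) by (simp add: inner_diff_left)
  with y(1) show ?thesis unfolding VI_solutions_def by blast
qed

text \<open>Testing each solution against the other and adding monotonicity leaves only the
  regularization, a multiple of the squared distance.\<close>

lemma VI_solutions_regularized_unique:
  fixes H :: "'a::euclidean_space \<Rightarrow> 'a"
  assumes mono: "monotone_map_on X H" and c: "c > 0"
    and y: "y \<in> VI_solutions X (\<lambda>x. H x + c *\<^sub>R x)"
    and w: "w \<in> VI_solutions X (\<lambda>x. H x + c *\<^sub>R x)"
  shows "y = w"
proof -
  from y w have "(H y + c *\<^sub>R y) \<bullet> (w - y) \<ge> 0" "(H w + c *\<^sub>R w) \<bullet> (y - w) \<ge> 0"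
    and "(H y - H w) \<bullet> (y - w) \<ge> 0"
    using mono unfolding VI_solutions_def monotone_map_on_def by auto
  then have "c * ((y - w) \<bullet> (y - w)) \<le> 0"
    by (simp add: inner_simps algebra_simps)
  with c show ?thesis
    using inner_ge_zero[of "y - w"] inner_eq_zero_iff[of "y - w"]
    by (metis eq_iff_diff_eq_0 linorder_not_less mult_pos_pos order_antisym_conv)
qed

lemma the_VI_solution:
  fixes H :: "'a::euclidean_space \<Rightarrow> 'a"
  assumes "compact X" "convex X" "X \<noteq> {}" "continuous_on X H" "monotone_map_on X H" "c > 0"
  shows "(THE y. y \<in> VI_solutions X (\<lambda>x. H x + c *\<^sub>R x)) \<in> VI_solutions X (\<lambda>x. H x + c *\<^sub>R x)"
proof (rule theI')
  have "VI_solutions X (\<lambda>x. H x + c *\<^sub>R x) \<noteq> {}"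
    using assms by (intro VI_solutions_nonempty continuous_intros)
  then show "\<exists>!y. y \<in> VI_solutions X (\<lambda>x. H x + c *\<^sub>R x)"
    using VI_solutions_regularized_unique[OF assms(5,6)] by blast
qed

text \<open>Each solution is tested against the other. Monotonicity of \<open>H'\<close> between
  \<open>w\<close> and \<open>y\<close> removes \<open>H' w\<close>, so the two mappings are
  compared only at \<open>y\<close>, and the modulus \<open>c\<close> converts the remaining error
  into a distance.\<close>

lemma VI_solution_perturbation:
  fixes H H' :: "'a::euclidean_space \<Rightarrow> 'a"
  assumes mono: "monotone_map_on X H'" and c: "c > 0"
    and y: "y \<in> VI_solutions X (\<lambda>x. H x + c *\<^sub>R x)"
    and w: "w \<in> VI_solutions X (\<lambda>x. H' x + c' *\<^sub>R x)"
    and R: "norm w \<le> R" and d: "norm (H' y - H y) \<le> d"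
  shows "norm (w - y) \<le> R * \<bar>1 - c' / c\<bar> + d / c"
proof (cases "w = y")
  case True
  have "R \<ge> 0" "d \<ge> 0" using R d norm_ge_zero order_trans by blast+
  then show ?thesis using True c by simp
next
  case False
  from y w have 1: "(H y + c *\<^sub>R y) \<bullet> (w - y) \<ge> 0" "(H' w + c' *\<^sub>R w) \<bullet> (y - w) \<ge> 0"
    and 2: "(H' w - H' y) \<bullet> (w - y) \<ge> 0"
    using mono unfolding VI_solutions_def monotone_map_on_def by auto
  have "c * ((w - y) \<bullet> (w - y)) \<le> (H' y - H y) \<bullet> (y - w) + ((c - c') *\<^sub>R w) \<bullet> (w - y)"
    using 1 2 by (simp add: inner_simps algebra_simps)
  also have "\<dots> \<le> norm (H' y - H y) * norm (y - w) + norm ((c - c') *\<^sub>R w) * norm (w - y)"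
    by (intro add_mono norm_cauchy_schwarz)
  also have "\<dots> \<le> d * norm (w - y) + (\<bar>c - c'\<bar> * R) * norm (w - y)"
    using R d by (simp add: norm_minus_commute mult_right_mono mult_left_mono add_mono)
  finally have "norm (w - y) * (c * norm (w - y)) \<le> norm (w - y) * (d + \<bar>c - c'\<bar> * R)"
    by (simp add: dot_square_norm power2_eq_square algebra_simps)
  then have "c * norm (w - y) \<le> d + \<bar>c - c'\<bar> * R"
    using False by (simp add: mult_le_cancel_left)
  then have "norm (w - y) \<le> (d + \<bar>c - c'\<bar> * R) / c"
    using c by (simp add: field_simps)
  also have "\<dots> = R * \<bar>1 - c' / c\<bar> + d / c"
  proof -
    have "\<bar>1 - c' / c\<bar> = \<bar>c - c'\<bar> / c"
    proof -
      have "1 - c' / c = (c - c') / c" using c by (simp add: field_simps)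
      then show ?thesis using c by (simp only: abs_divide abs_of_pos)
    qed
    then show ?thesis by (simp add: add_divide_distrib)
  qed
  finally show ?thesis .
qed

section \<open>The projected step and quadratic estimates\<close>

text \<open>The projection is nonexpansive and fixes \<open>y\<close>, so it can only improve on the
  unprojected step, whose square is then expanded.\<close>

lemma norm_diff_closest_point_step:
  fixes x :: "'a::euclidean_space"
  assumes "convex X" "closed X" "y \<in> X"
  shows "(norm (closest_point X (x - c *\<^sub>R g) - y))\<^sup>2
    \<le> (norm (x - y))\<^sup>2 - 2 * c * (g \<bullet> (x - y)) + c\<^sup>2 * (norm g)\<^sup>2"
proof -
  have "dist (closest_point X (x - c *\<^sub>R g)) (closest_point X y) \<le> dist (x - c *\<^sub>R g) y"
    using assms by (intro closest_point_lipschitz) auto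
  then have "norm (closest_point X (x - c *\<^sub>R g) - y) \<le> norm ((x - y) - c *\<^sub>R g)"
    using closest_point_self[OF assms(3)] by (simp add: dist_norm algebra_simps)
  then have "(norm (closest_point X (x - c *\<^sub>R g) - y))\<^sup>2 \<le> (norm ((x - y) - c *\<^sub>R g))\<^sup>2"
    by (rule power_mono) simp
  also have "\<dots> = (norm (x - y))\<^sup>2 - 2 * c * (g \<bullet> (x - y)) + c\<^sup>2 * (norm g)\<^sup>2"
    unfolding power2_norm_eq_inner
    by (simp add: inner_diff_left inner_diff_right inner_commute power2_eq_square algebra_simps)
  finally show ?thesis .
qed

text \<open>Young's inequality. A small \<open>u\<close> keeps the first coefficient near 1, as
  needed when the target of the tracking moves; \<open>u = 1\<close> gives the plain factor
  2.\<close>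

lemma norm_add_squared_le:
  fixes a b :: "'a::real_inner"
  assumes "u > 0"
  shows "(norm (a + b))\<^sup>2 \<le> (1 + u) * (norm a)\<^sup>2 + (1 + 1 / u) * (norm b)\<^sup>2"
proof -
  have "0 \<le> (norm (u *\<^sub>R a - b))\<^sup>2 / u" using assms by simp
  also have "\<dots> = u * (norm a)\<^sup>2 - 2 * (a \<bullet> b) + (norm b)\<^sup>2 / u"
    using assms unfolding power2_norm_eq_inner
    by (simp add: inner_diff_left inner_diff_right inner_commute field_simps power2_eq_square)
  finally show ?thesis
    unfolding power2_norm_eq_inner by (simp add: inner_simps inner_commute algebra_simps)
qed

lemma square_add_le: "(a + b :: real)\<^sup>2 \<le> 2 * a\<^sup>2 + 2 * b\<^sup>2"
  using zero_le_power2[of "a - b"] by (simp add: power2_eq_square algebra_simps)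

lemma compact_enlargement:
  fixes X :: "'a::euclidean_space set"
  shows "compact X \<Longrightarrow> compact (enlargement X e)"
  unfolding enlargement_def by (intro compact_sums) auto

lemma mem_enlargement: "x \<in> X \<Longrightarrow> norm z \<le> e \<Longrightarrow> x + z \<in> enlargement X e"
  unfolding enlargement_def by auto

section \<open>A deterministic recursion with divergent contraction\<close>

text \<open>Adding the tail sums of \<beta> to \<open>v\<close> gives an eventually decreasing
  sequence, so \<open>v\<close> has a limit. Were this limit positive, the decrease would dominate a
  multiple of the partial sums of \<open>u\<close> and bound them.\<close>

lemma recursion_tendsto_zero:
  fixes v u \<beta> :: "nat \<Rightarrow> real"
  assumes v: "\<And>k. v k \<ge> 0" and u: "\<And>k. u k \<ge> 0" and \<beta>: "\<And>k. \<beta> k \<ge> 0" "summable \<beta>"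
    and div: "filterlim (\<lambda>m. \<Sum>k<m. u k) at_top sequentially"
    and rec: "\<And>k. k \<ge> K \<Longrightarrow> v (Suc k) \<le> (1 - u k) * v k + \<beta> k"
  shows "v \<longlonglongrightarrow> 0"
proof -
  define T where "T k = (\<Sum>j. \<beta> (j + k))" for k
  have T_suc: "T k = \<beta> k + T (Suc k)" for k
    using suminf_split_head[of "\<lambda>j. \<beta> (j + k)"] summable_iff_shift[of \<beta> k] \<beta>(2)
    by (simp add: T_def)
  have T_lim: "T \<longlonglongrightarrow> 0" unfolding T_def by (rule suminf_exist_split2[OF \<beta>(2)])
  have T_nonneg: "T k \<ge> 0" for k
    unfolding T_def using \<beta> by (intro suminf_nonneg) (auto simp: summable_iff_shift)
  define w where "w k = v k + T k" for k
  have w_rec: "w (Suc k) \<le> w k - u k * v k" if "k \<ge> K" for k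
    using rec[OF that] T_suc[of k] by (simp add: w_def algebra_simps)
  have "decseq (\<lambda>k. w (k + K))"
  proof (rule decseq_SucI)
    show "w (Suc n + K) \<le> w (n + K)" for n
      using w_rec[of "n + K"] mult_nonneg_nonneg[OF u[of "n + K"] v[of "n + K"]] by simp
  qed
  moreover have "w (k + K) \<ge> 0" for k using v T_nonneg by (simp add: w_def)
  ultimately obtain L where "(\<lambda>k. w (k + K)) \<longlonglongrightarrow> L" and Lw: "\<And>k. L \<le> w (k + K)"
    using decseq_convergent[of "\<lambda>k. w (k + K)" 0] by blast
  then have "w \<longlonglongrightarrow> L" using LIMSEQ_offset by blast
  then have "(\<lambda>k. w k - T k) \<longlonglongrightarrow> L - 0" by (rule tendsto_diff[OF _ T_lim])
  then have v_lim: "v \<longlonglongrightarrow> L" by (simp add: w_def)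
  have "L \<ge> 0" using v_lim v by (simp add: LIMSEQ_le_const)
  moreover have "\<not> L > 0"
  proof
    assume "L > 0"
    then have "\<forall>\<^sub>F k in sequentially. v k > L / 2"
      using v_lim by (intro order_tendstoD) auto
    then obtain N0 where N0: "\<And>k. k \<ge> N0 \<Longrightarrow> v k > L / 2"
      by (auto simp: eventually_sequentially)
    define N where "N = max N0 K"
    \<comment> \<open>From \<open>N\<close> on, \<open>v\<close> exceeds \<open>L / 2\<close> and
      \<open>w\<close> drops by at least \<open>u k * v k\<close> at each index, so the drops
      telescope.\<close>
    have tel: "(L / 2) * (\<Sum>k=N..<N+m. u k) \<le> w N - w (N + m)" for m
    proof (induction m)
      case (Suc m)
      have "u (N + m) * (L / 2) \<le> u (N + m) * v (N + m)"
        using u N0[of "N + m"] by (intro mult_left_mono) (auto simp: N_def less_imp_le)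
      moreover have "w (Suc (N + m)) \<le> w (N + m) - u (N + m) * v (N + m)"
        by (rule w_rec) (simp add: N_def)
      moreover have "(L / 2) * (\<Sum>k=N..<N + Suc m. u k)
          = (L / 2) * (\<Sum>k=N..<N+m. u k) + u (N + m) * (L / 2)"
        by (simp add: algebra_simps)
      ultimately show ?case using Suc by (simp only: add_Suc_right)
    qed simp
    have bd: "(\<Sum>k<m. u k) \<le> (\<Sum>k<N. u k) + 2 * w N / L" for m
    proof (cases "m \<le> N")
      case True
      then have "(\<Sum>k<m. u k) \<le> (\<Sum>k<N. u k)" using u by (intro sum_mono2) auto
      moreover have "0 \<le> 2 * w N / L" using v T_nonneg \<open>L > 0\<close> by (simp add: w_def)
      ultimately show ?thesis by simp
    next
      case False
      have "w (N + (m - N)) \<ge> 0" using v T_nonneg by (simp add: w_def)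
      with tel[of "m - N"] have "(L / 2) * (\<Sum>k=N..<m. u k) \<le> w N"
        using False by simp
      then have "(\<Sum>k=N..<m. u k) \<le> 2 * w N / L" using \<open>L > 0\<close> by (simp add: field_simps)
      moreover have "(\<Sum>k<m. u k) = (\<Sum>k<N. u k) + (\<Sum>k=N..<m. u k)"
        using False by (simp add: lessThan_atLeast0 sum.atLeastLessThan_concat)
      ultimately show ?thesis by simp
    qed
    have "\<forall>\<^sub>F m in sequentially. (\<Sum>k<m. u k) > (\<Sum>k<N. u k) + 2 * w N / L"
      using div by (simp add: filterlim_at_top_dense)
    then obtain m where "(\<Sum>k<m. u k) > (\<Sum>k<N. u k) + 2 * w N / L"
      using eventually_happens sequentially_bot by blast
    with bd[of m] show False by simp
  qed
  ultimately show ?thesis using v_lim by simp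
qed

section \<open>Least-norm solutions and Jacobian bounds\<close>

text \<open>\<open>ARG_MIN\<close> is a Hilbert choice and says nothing until a minimizer is known
  to exist; compactness provides one.\<close>

lemma arg_min_norm_mem:
  fixes S :: "'a::euclidean_space set"
  assumes "compact S" "S \<noteq> {}"
  shows "(ARG_MIN norm y. y \<in> S) \<in> S" "\<And>w. w \<in> S \<Longrightarrow> norm (ARG_MIN norm y. y \<in> S) \<le> norm w"
proof -
  obtain y where "y \<in> S" "\<And>w. w \<in> S \<Longrightarrow> norm y \<le> norm w"
    using continuous_attains_inf[OF assms, of norm] by (auto intro: continuous_intros)
  then have "is_arg_min norm (\<lambda>y. y \<in> S) y" by (auto simp: is_arg_min_linorder)
  then have "is_arg_min norm (\<lambda>y. y \<in> S) (arg_min norm (\<lambda>y. y \<in> S))"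
    unfolding arg_min_def by (rule someI)
  then show "(ARG_MIN norm y. y \<in> S) \<in> S" "\<And>w. w \<in> S \<Longrightarrow> norm (ARG_MIN norm y. y \<in> S) \<le> norm w"
    by (auto simp: is_arg_min_linorder)
qed

text \<open>The defining inequalities survive limits, so the solutions form a closed part of
  \<open>X\<close>. This is what makes the least-norm solution exist.\<close>

lemma compact_VI_solutions:
  fixes H :: "'a::euclidean_space \<Rightarrow> 'a"
  assumes "compact X" "continuous_on X H"
  shows "compact (VI_solutions X H)"
proof -
  have "closed (VI_solutions X H)"
    unfolding closed_sequential_limits
  proof (intro allI impI)
    fix q l assume q: "(\<forall>n. q n \<in> VI_solutions X H) \<and> q \<longlonglongrightarrow> l"
    then have qX: "\<And>n. q n \<in> X" by (auto simp: VI_solutions_def)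
    then have l: "l \<in> X" using q compact_imp_closed[OF assms(1)] closed_sequentially by blast
    have Hq: "(\<lambda>n. H (q n)) \<longlonglongrightarrow> H l"
      using continuous_on_tendsto_compose[OF assms(2), of q l sequentially] q qX l by auto
    have "H l \<bullet> (y - l) \<ge> 0" if "y \<in> X" for y
    proof (rule LIMSEQ_le_const)
      show "(\<lambda>n. H (q n) \<bullet> (y - q n)) \<longlonglongrightarrow> H l \<bullet> (y - l)"
        using q by (intro tendsto_intros Hq) auto
      show "\<exists>N. \<forall>n\<ge>N. 0 \<le> H (q n) \<bullet> (y - q n)"
        using q that by (auto simp: VI_solutions_def)
    qed
    with l show "l \<in> VI_solutions X H" by (auto simp: VI_solutions_def)
  qed
  moreover have "VI_solutions X H = X \<inter> VI_solutions X H" by (auto simp: VI_solutions_def)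
  ultimately show ?thesis using assms(1) by (metis compact_Int_closed)
qed

lemma lipschitz_bound_of_bounded_jacobian:
  fixes F :: "real ^ 'n \<Rightarrow> real ^ 'n"
  assumes diff: "\<And>y. y \<in> ball t r \<Longrightarrow> F differentiable (at y)"
    and bdd: "bounded ((\<lambda>y. jacobian F (at y)) ` ball t r)"
  obtains L where "L \<ge> 0" "\<And>y w. y \<in> ball t r \<Longrightarrow> w \<in> ball t r \<Longrightarrow> norm (F y - F w) \<le> L * norm (y - w)"
proof -
  from bdd obtain B where B: "\<And>y. y \<in> ball t r \<Longrightarrow> norm (jacobian F (at y)) \<le> B"
    unfolding bounded_iff by blast
  \<comment> \<open>Bounding each matrix entry by \<open>B\<close> costs the square of the dimension
    in the operator norm. The maximum covers an empty ball, for which \<open>B\<close> may be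
    negative.\<close>
  define L where "L = max 0 (real CARD('n) * real CARD('n) * B)"
  have "norm (F y - F w) \<le> L * norm (y - w)" if "y \<in> ball t r" "w \<in> ball t r" for y w
  proof (rule differentiable_bound[OF convex_ball])
    show "(F has_derivative (\<lambda>h. jacobian F (at v) *v h)) (at v within ball t r)"
      if "v \<in> ball t r" for v
      using diff[OF that] jacobian_works[of F "at v"] by (auto intro: has_derivative_at_withinI)
    show "onorm ((*v) (jacobian F (at v))) \<le> L" if "v \<in> ball t r" for v
    proof -
      have "\<bar>jacobian F (at v) $ i $ j\<bar> \<le> B" for i j
        using B[OF that] component_le_norm_cart[of "jacobian F (at v) $ i" j]
          Finite_Cartesian_Product.norm_nth_le[of "jacobian F (at v)" i] by linarith
      then have "onorm ((*v) (jacobian F (at v))) \<le> real CARD('n) * real CARD('n) * B"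
        by (intro onorm_le_matrix_component)
      then show ?thesis by (simp add: L_def)
    qed
  qed (use that in auto)
  moreover have "L \<ge> 0" by (simp add: L_def)
  ultimately show thesis using that by blast
qed

section \<open>Almost supermartingales\<close>

text \<open>This is optional stopping at the first passage above \<open>c\<close>, done by hand. The
  second summand, the mass of \<open>W\<close> on paths that have not yet reached \<open>c\<close>,
  is what the induction on \<open>m\<close> feeds on: part of it is exchanged for probability of
  crossing, the rest is propagated by \<open>rec\<close>.\<close>

lemma (in prob_space) supermartingale_maximal_finite:
  fixes W :: "nat \<Rightarrow> 'a \<Rightarrow> real" and G :: "nat \<Rightarrow> 'a measure"
  assumes sub: "\<And>k. sets (G k) \<subseteq> sets M" "\<And>k. space (G k) = space M"
    and mono: "\<And>k. sets (G k) \<subseteq> sets (G (Suc k))"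
    and meas: "\<And>k. W k \<in> borel_measurable (G k)"
    and nonneg: "\<And>k \<omega>. W k \<omega> \<ge> 0" and int: "\<And>k. integrable M (W k)"
    and rec: "\<And>k A. k \<ge> N \<Longrightarrow> A \<in> sets (G k) \<Longrightarrow>
      (\<integral>\<omega>. indicator A \<omega> * W (Suc k) \<omega> \<partial>M) \<le> (\<integral>\<omega>. indicator A \<omega> * W k \<omega> \<partial>M)"
  shows "c * prob {\<omega>\<in>space M. \<exists>j\<in>{N..<N+m}. W j \<omega> \<ge> c}
    + (\<integral>\<omega>. indicator {\<omega>\<in>space M. \<forall>j\<in>{N..<N+m}. W j \<omega> < c} \<omega> * W (N + m) \<omega> \<partial>M) \<le> expectation (W N)"
proof (induction m)
  case 0
  have "(\<integral>\<omega>. indicator (space M) \<omega> * W N \<omega> \<partial>M) = expectation (W N)"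
    by (intro Bochner_Integration.integral_cong) auto
  then show ?case by simp
next
  case (Suc m)
  define S where "S m = {\<omega>\<in>space M. \<forall>j\<in>{N..<N+m}. W j \<omega> < c}" for m
  define D where "D m = {\<omega>\<in>space M. \<exists>j\<in>{N..<N+m}. W j \<omega> \<ge> c}" for m
  have G_le: "sets (G i) \<subseteq> sets (G j)" if "i \<le> j" for i j
    using lift_Suc_mono_le[of "\<lambda>k. sets (G k)"] mono that by blast
  have [measurable]: "W k \<in> borel_measurable M" for k using int by blast
  have [measurable]: "S k \<in> sets M" "D k \<in> sets M" for k
    unfolding S_def D_def by measurable
  \<comment> \<open>Only \<open>W j\<close> with \<open>j \<le> N + m\<close> decide membership in
    \<open>S (Suc m)\<close>, so it is an event of \<open>G (N + m)\<close> and \<open>rec\<close>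
    applies to it at that time.\<close>
  have S_eq: "S (Suc m) = (\<Inter>j\<in>{N..N+m}. {\<omega>\<in>space (G (N + m)). W j \<omega> < c})"
    unfolding S_def using sub(2) by (force simp: less_Suc_eq_le)
  have "S (Suc m) \<in> sets (G (N + m))"
    unfolding S_eq
  proof (intro sets.finite_INT)
    fix j assume j: "j \<in> {N..N + m}"
    have "{\<omega>\<in>space (G j). W j \<omega> < c} \<in> sets (G j)"
      using meas[of j] by measurable
    then show "{\<omega>\<in>space (G (N + m)). W j \<omega> < c} \<in> sets (G (N + m))"
      using G_le[of j "N + m"] j sub(2) by auto
  qed auto
  from rec[OF _ this]
  have step: "(\<integral>\<omega>. indicator (S (Suc m)) \<omega> * W (Suc (N + m)) \<omega> \<partial>M)
      \<le> (\<integral>\<omega>. indicator (S (Suc m)) \<omega> * W (N + m) \<omega> \<partial>M)" by simp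
  have int_ind: "integrable M (\<lambda>\<omega>. indicator A \<omega> * W k \<omega>)" if "A \<in> sets M" for A k
    using integrable_mult_indicator[OF that int[of k]] by simp
  \<comment> \<open>\<open>S m\<close> splits into \<open>S (Suc m)\<close> and the paths crossing
    for the first time at \<open>N + m\<close>, on which \<open>W (N + m)\<close> is at least
    \<open>c\<close>.\<close>
  have "(\<integral>\<omega>. c * indicator (D (Suc m) - D m) \<omega> + indicator (S (Suc m)) \<omega> * W (N + m) \<omega> \<partial>M)
      \<le> (\<integral>\<omega>. indicator (S m) \<omega> * W (N + m) \<omega> \<partial>M)"
  proof (rule integral_mono)
    show "integrable M (\<lambda>\<omega>. c * indicator (D (Suc m) - D m) \<omega> + indicator (S (Suc m)) \<omega> * W (N + m) \<omega>)"
      by (intro Bochner_Integration.integrable_add int_ind integrable_mult_right integrable_real_indicator)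
         (auto simp: emeasure_eq_measure)
    show "c * indicator (D (Suc m) - D m) \<omega> + indicator (S (Suc m)) \<omega> * W (N + m) \<omega>
        \<le> indicator (S m) \<omega> * W (N + m) \<omega>" for \<omega>
      using nonneg[of "N + m" \<omega>]
      by (auto simp: S_def D_def indicator_def atLeastLessThanSuc not_less split: if_splits)
  qed (simp add: int_ind)
  moreover have "(\<integral>\<omega>. c * indicator (D (Suc m) - D m) \<omega> + indicator (S (Suc m)) \<omega> * W (N + m) \<omega> \<partial>M)
      = c * prob (D (Suc m) - D m) + (\<integral>\<omega>. indicator (S (Suc m)) \<omega> * W (N + m) \<omega> \<partial>M)"
    by (subst Bochner_Integration.integral_add)
       (auto intro!: int_ind integrable_mult_right integrable_real_indicator simp: emeasure_eq_measure)
  moreover have "prob (D (Suc m)) = prob (D m) + prob (D (Suc m) - D m)"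
  proof -
    have "D m \<subseteq> D (Suc m)" by (force simp: D_def)
    then show ?thesis by (simp add: finite_measure_Diff)
  qed
  ultimately have "c * prob (D (Suc m)) + (\<integral>\<omega>. indicator (S (Suc m)) \<omega> * W (N + Suc m) \<omega> \<partial>M)
      \<le> c * prob (D m) + (\<integral>\<omega>. indicator (S m) \<omega> * W (N + m) \<omega> \<partial>M)"
    using step by (simp add: algebra_simps)
  with Suc show ?case unfolding S_def D_def by linarith
qed

text \<open>The finite horizon bound does not depend on \<open>m\<close>, and the crossing events
  increase to the event of ever crossing after \<open>N\<close>.\<close>

lemma (in prob_space) supermartingale_maximal:
  fixes W :: "nat \<Rightarrow> 'a \<Rightarrow> real" and G :: "nat \<Rightarrow> 'a measure"
  assumes sub: "\<And>k. sets (G k) \<subseteq> sets M" "\<And>k. space (G k) = space M"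
    and mono: "\<And>k. sets (G k) \<subseteq> sets (G (Suc k))"
    and meas: "\<And>k. W k \<in> borel_measurable (G k)"
    and nonneg: "\<And>k \<omega>. W k \<omega> \<ge> 0" and int: "\<And>k. integrable M (W k)"
    and rec: "\<And>k A. k \<ge> N \<Longrightarrow> A \<in> sets (G k) \<Longrightarrow>
      (\<integral>\<omega>. indicator A \<omega> * W (Suc k) \<omega> \<partial>M) \<le> (\<integral>\<omega>. indicator A \<omega> * W k \<omega> \<partial>M)"
  shows "c * prob {\<omega>\<in>space M. \<exists>j\<ge>N. W j \<omega> \<ge> c} \<le> expectation (W N)"
proof -
  define D where "D m = {\<omega>\<in>space M. \<exists>j\<in>{N..<N+m}. W j \<omega> \<ge> c}" for m
  have [measurable]: "W k \<in> borel_measurable M" for k using int by blast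
  have [measurable]: "D m \<in> sets M" for m unfolding D_def by measurable
  have "c * prob (D m) \<le> expectation (W N)" for m
  proof -
    have "0 \<le> (\<integral>\<omega>. indicator {\<omega>\<in>space M. \<forall>j\<in>{N..<N+m}. W j \<omega> < c} \<omega> * W (N + m) \<omega> \<partial>M)"
      by (intro integral_nonneg_AE AE_I2 mult_nonneg_nonneg nonneg) auto
    moreover have "c * prob (D m)
        + (\<integral>\<omega>. indicator {\<omega>\<in>space M. \<forall>j\<in>{N..<N+m}. W j \<omega> < c} \<omega> * W (N + m) \<omega> \<partial>M) \<le> expectation (W N)"
      unfolding D_def by (rule supermartingale_maximal_finite[of G W N]) (fact assms)+
    ultimately show ?thesis by linarith
  qed
  moreover have "(\<lambda>m. c * prob (D m)) \<longlonglongrightarrow> c * prob (\<Union>m. D m)"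
    by (intro tendsto_intros finite_Lim_measure_incseq) (force simp: incseq_def D_def)+
  moreover have "(\<Union>m. D m) = {\<omega>\<in>space M. \<exists>j\<ge>N. W j \<omega> \<ge> c}"
  proof (intro set_eqI iffI)
    fix \<omega> assume "\<omega> \<in> {\<omega>\<in>space M. \<exists>j\<ge>N. W j \<omega> \<ge> c}"
    then obtain j where "\<omega> \<in> space M" "j \<ge> N" "W j \<omega> \<ge> c" by auto
    then have "\<omega> \<in> D (Suc j - N)" by (auto simp: D_def)
    then show "\<omega> \<in> (\<Union>m. D m)" by blast
  qed (auto simp: D_def)
  ultimately show ?thesis by (metis LIMSEQ_le_const2)
qed

text \<open>Adding the tail of \<open>\<beta>\<close> turns \<open>V\<close> into a supermartingale whose mean tends to 0, so the
  maximal inequality controls the supremum of its tails.\<close>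

lemma (in prob_space) AE_almost_supermartingale_tendsto_zero:
  fixes V :: "nat \<Rightarrow> 'a \<Rightarrow> real" and G :: "nat \<Rightarrow> 'a measure" and u \<beta> :: "nat \<Rightarrow> real"
  assumes sub: "\<And>k. sets (G k) \<subseteq> sets M" "\<And>k. space (G k) = space M"
    and mono: "\<And>k. sets (G k) \<subseteq> sets (G (Suc k))"
    and meas: "\<And>k. V k \<in> borel_measurable (G k)"
    and nonneg: "\<And>k \<omega>. V k \<omega> \<ge> 0" and int: "\<And>k. integrable M (V k)"
    and u: "\<And>k. u k \<ge> 0" and \<beta>: "\<And>k. \<beta> k \<ge> 0" "summable \<beta>"
    and div: "filterlim (\<lambda>m. \<Sum>k<m. u k) at_top sequentially"
    and rec: "\<And>k A. k \<ge> K \<Longrightarrow> A \<in> sets (G k) \<Longrightarrow>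
      (\<integral>\<omega>. indicator A \<omega> * V (Suc k) \<omega> \<partial>M)
        \<le> (1 - u k) * (\<integral>\<omega>. indicator A \<omega> * V k \<omega> \<partial>M) + \<beta> k * prob A"
  shows "AE \<omega> in M. (\<lambda>k. V k \<omega>) \<longlonglongrightarrow> 0"
proof -
  define T where "T k = (\<Sum>j. \<beta> (j + k))" for k
  have T_suc: "T k = \<beta> k + T (Suc k)" for k
    using suminf_split_head[of "\<lambda>j. \<beta> (j + k)"] summable_iff_shift[of \<beta> k] \<beta>(2)
    by (simp add: T_def)
  have T_lim: "T \<longlonglongrightarrow> 0" unfolding T_def by (rule suminf_exist_split2[OF \<beta>(2)])
  have T_nonneg: "T k \<ge> 0" for k
    unfolding T_def using \<beta> by (intro suminf_nonneg) (auto simp: summable_iff_shift)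
  have int_ind: "integrable M (\<lambda>\<omega>. indicator A \<omega> * V k \<omega>)" if "A \<in> sets M" for A k
    using integrable_mult_indicator[OF that int[of k]] by simp
  have "(\<lambda>k. expectation (V k)) \<longlonglongrightarrow> 0"
  proof (rule recursion_tendsto_zero[OF _ u \<beta> div])
    show "0 \<le> expectation (V k)" for k by (simp add: nonneg)
    show "expectation (V (Suc k)) \<le> (1 - u k) * expectation (V k) + \<beta> k" if "K \<le> k" for k
    proof -
      have "(\<integral>\<omega>. indicator (space M) \<omega> * V k \<omega> \<partial>M) = expectation (V k)" for k
        by (intro Bochner_Integration.integral_cong) auto
      then show ?thesis
        using rec[OF that, of "space M"] sets.top[of "G k"] sub(2)[of k] by (simp add: prob_space)
    qed
  qed
  define W where "W k \<omega> = V k \<omega> + T k" for k \<omega>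
  have W_int: "integrable M (W k)" for k unfolding W_def by (intro Bochner_Integration.integrable_add int) simp
  have "(\<lambda>k. expectation (V k) + T k) \<longlonglongrightarrow> 0 + 0" by (intro tendsto_add T_lim) fact
  then have EW_lim: "(\<lambda>k. expectation (W k)) \<longlonglongrightarrow> 0"
    by (simp add: W_def[abs_def] Bochner_Integration.integral_add int prob_space)
  have W_rec: "(\<integral>\<omega>. indicator A \<omega> * W (Suc k) \<omega> \<partial>M) \<le> (\<integral>\<omega>. indicator A \<omega> * W k \<omega> \<partial>M)"
    if k: "k \<ge> K" and A: "A \<in> sets (G k)" for k A
  proof -
    have [measurable]: "A \<in> sets M" using A sub(1) by blast
    have W_ind: "(\<integral>\<omega>. indicator A \<omega> * W j \<omega> \<partial>M) = (\<integral>\<omega>. indicator A \<omega> * V j \<omega> \<partial>M) + T j * prob A" for j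
    proof -
      have "(\<integral>\<omega>. indicator A \<omega> * W j \<omega> \<partial>M) = (\<integral>\<omega>. indicator A \<omega> * V j \<omega> + T j * indicator A \<omega> \<partial>M)"
        by (simp add: W_def algebra_simps)
      also have "\<dots> = (\<integral>\<omega>. indicator A \<omega> * V j \<omega> \<partial>M) + (\<integral>\<omega>. T j * indicator A \<omega> \<partial>M)"
        by (rule Bochner_Integration.integral_add)
           (auto intro!: int_ind integrable_mult_right integrable_real_indicator simp: emeasure_eq_measure)
      finally show ?thesis by simp
    qed
    have "0 \<le> u k * (\<integral>\<omega>. indicator A \<omega> * V k \<omega> \<partial>M)"
      by (intro mult_nonneg_nonneg u integral_nonneg_AE AE_I2 nonneg) auto
    with rec[OF k A] show ?thesis unfolding W_ind T_suc[of k] by (simp add: algebra_simps)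
  qed
  have W_meas: "W k \<in> borel_measurable (G k)" for k unfolding W_def using meas[of k] by measurable
  have [measurable]: "W k \<in> borel_measurable M" for k using W_int by blast
  have maximal: "c * prob {\<omega>\<in>space M. \<exists>j\<ge>N. W j \<omega> \<ge> c} \<le> expectation (W N)" if "N \<ge> K" for c N
    by (rule supermartingale_maximal[of G W N])
       (use that nonneg T_nonneg W_rec sub mono W_meas W_int in \<open>auto simp: W_def\<close>)
  have small: "AE \<omega> in M. \<exists>N. \<forall>j\<ge>N. W j \<omega> < c" if c: "c > 0" for c
  proof -
    \<comment> \<open>\<open>D\<close> is the event that \<open>W\<close> reaches \<open>c\<close>
      infinitely often. It lies in the crossing event of every starting time \<open>N\<close>, so
      the maximal bound may be used with \<open>N\<close> tending to infinity.\<close>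
    define D where "D = {\<omega>\<in>space M. \<forall>N. \<exists>j\<ge>N. W j \<omega> \<ge> c}"
    have [measurable]: "D \<in> sets M" unfolding D_def by measurable
    have "prob D \<le> expectation (W N) / c" if "N \<ge> K" for N
    proof -
      have "prob D \<le> prob {\<omega>\<in>space M. \<exists>j\<ge>N. W j \<omega> \<ge> c}"
        by (rule finite_measure_mono) (auto simp: D_def)
      then have "c * prob D \<le> expectation (W N)"
        using maximal[OF that, of c] c mult_left_mono[of _ _ c] by (smt (verit))
      then show ?thesis using c by (simp add: field_simps)
    qed
    moreover have "(\<lambda>N. expectation (W N) / c) \<longlonglongrightarrow> 0 / c" by (intro tendsto_divide EW_lim) (use c in auto)
    ultimately have "prob D \<le> 0" by (intro LIMSEQ_le_const[of _ 0]) auto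
    then have "prob D = 0" using measure_nonneg[of M D] by linarith
    then have "AE \<omega> in M. \<omega> \<notin> D" by (simp add: AE_iff_measurable[OF _ refl] prob_eq_0)
    then show ?thesis
    proof (rule AE_mp, intro AE_I2 impI)
      fix \<omega> assume "\<omega> \<in> space M" "\<omega> \<notin> D"
      then have "\<not> (\<forall>N. \<exists>j\<ge>N. c \<le> W j \<omega>)" unfolding D_def by blast
      then show "\<exists>N. \<forall>j\<ge>N. W j \<omega> < c" by (simp only: not_all not_ex de_Morgan_conj not_le imp_conv_disj)
    qed
  qed
  \<comment> \<open>Countably many thresholds suffice for convergence to 0, which lets the
    quantifier move inside the almost sure statement.\<close>
  have "AE \<omega> in M. \<forall>i::nat. \<exists>N. \<forall>j\<ge>N. W j \<omega> < inverse (real (Suc i))"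
    unfolding AE_all_countable by (intro allI small) simp
  then show ?thesis
  proof (rule AE_mp, intro AE_I2 impI)
    fix \<omega> assume W: "\<forall>i::nat. \<exists>N. \<forall>j\<ge>N. W j \<omega> < inverse (real (Suc i))"
    show "(\<lambda>k. V k \<omega>) \<longlonglongrightarrow> 0"
    proof (rule LIMSEQ_I)
      fix r :: real assume "r > 0"
      then obtain i where i: "inverse (real (Suc i)) < r" using reals_Archimedean by blast
      from W obtain N where "\<And>j. j \<ge> N \<Longrightarrow> W j \<omega> < inverse (real (Suc i))" by blast
      then have "norm (V j \<omega> - 0) < r" if "j \<ge> N" for j
        using i that nonneg[of j \<omega>] T_nonneg[of j] unfolding W_def
        by (smt (verit) real_norm_def)
      then show "\<exists>N. \<forall>j\<ge>N. norm (V j \<omega> - 0) < r" by blast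
    qed
  qed
qed

section \<open>Uniform distributions on balls and independence\<close>

text \<open>Bernoulli's inequality, used to replace the volume ratio \<open>(r / R) ^ n\<close> by
  the ratio of radii that occurs in the step conditions.\<close>

lemma one_minus_power_le:
  fixes q :: real
  assumes "0 \<le> q" "q \<le> 1"
  shows "1 - q ^ n \<le> real n * (1 - q)"
proof (induction n)
  case (Suc n)
  have "1 - q ^ Suc n = (1 - q) + q * (1 - q ^ n)" by (simp add: algebra_simps)
  also have "\<dots> \<le> (1 - q) + 1 * (real n * (1 - q))"
    using Suc assms by (intro add_left_mono mult_mono) (auto simp: power_le_one)
  finally show ?case by (simp add: algebra_simps)
qed simp

lemma integral_uniform_measure:
  fixes f :: "'a \<Rightarrow> 'b::{banach, second_countable_topology}"
  assumes A: "A \<in> sets M" "0 < emeasure M A" "emeasure M A < \<infinity>"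
    and f [measurable]: "f \<in> borel_measurable M"
  shows "(\<integral>x. f x \<partial>uniform_measure M A) = (\<integral>x. (indicator A x / measure M A) *\<^sub>R f x \<partial>M)"
proof -
  note [measurable] = A(1)
  have m: "emeasure M A = ennreal (measure M A)"
    using A(3) by (intro emeasure_eq_ennreal_measure) auto
  with A(2) have pos: "measure M A > 0" by simp
  have "uniform_measure M A = density M (\<lambda>x. ennreal (indicator A x / measure M A))"
    unfolding uniform_measure_def m
    by (intro arg_cong2[where f = density] refl ext)
       (simp add: divide_ennreal[OF _ pos, symmetric] ennreal_indicator)
  then show ?thesis by (simp add: integral_density)
qed

text \<open>Only boundedness of \<open>f\<close> is available, so the difference is at most
  \<open>B\<close> times the L1 distance of the two densities. The smaller ball carries the larger
  density, which makes that distance \<open>2 * (1 - (r / R) ^ DIM('a))\<close>.\<close>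

lemma norm_integral_uniform_ball_diff_le:
  fixes f :: "'a::euclidean_space \<Rightarrow> 'b::{banach, second_countable_topology}"
  assumes r: "0 < r" "r \<le> R" and f [measurable]: "f \<in> borel_measurable borel" and B: "\<And>x. norm (f x) \<le> B"
  shows "norm ((\<integral>x. f x \<partial>uniform_measure lborel (cball 0 R)) - (\<integral>x. f x \<partial>uniform_measure lborel (cball 0 r)))
    \<le> 2 * B * DIM('a) * (1 - r / R)"
proof -
  define V where "V \<rho> = measure lborel (cball (0::'a) \<rho>)" for \<rho>
  define g :: "real \<Rightarrow> 'a \<Rightarrow> real" where "g \<rho> x = indicator (cball 0 \<rho>) x / V \<rho>" for \<rho> x
  have V: "V \<rho> = unit_ball_vol DIM('a) * \<rho> ^ DIM('a)" if "\<rho> > 0" for \<rho>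
    using that content_cball[of \<rho> "0::'a"] by (simp add: V_def)
  have V_pos: "V \<rho> > 0" if "\<rho> > 0" for \<rho> using that by (simp add: V)
  have em: "emeasure lborel (cball (0::'a) \<rho>) = ennreal (V \<rho>)" if "\<rho> > 0" for \<rho>
    using that emeasure_cball[of \<rho> "0::'a"] by (simp add: V)
  have int_ind: "integrable lborel (indicator (cball (0::'a) \<rho>) :: 'a \<Rightarrow> real)" if "\<rho> > 0" for \<rho>
    using em[OF that] by (intro integrable_real_indicator) auto
  have g_int: "integrable lborel (g \<rho>)" if "\<rho> > 0" for \<rho>
    unfolding g_def using int_ind[OF that] by simp
  have [measurable]: "cball (0::'a) \<rho> \<in> sets borel" for \<rho> by simp
  have [measurable]: "g \<rho> \<in> borel_measurable borel" for \<rho> unfolding g_def by measurable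
  have gf_int: "integrable lborel (\<lambda>x. g \<rho> x *\<^sub>R f x)" if "\<rho> > 0" for \<rho>
  proof (rule Bochner_Integration.integrable_bound)
    show "integrable lborel (\<lambda>x. B * g \<rho> x)" using g_int[OF that] by simp
    show "AE x in lborel. norm (g \<rho> x *\<^sub>R f x) \<le> norm (B * g \<rho> x)"
      using B by (auto simp: abs_mult mult.commute[of B] intro!: mult_left_mono AE_I2 order_trans[OF B])
  qed measurable
  have "R > 0" using r by simp
  note pos = r(1) this
  have avg: "(\<integral>x. f x \<partial>uniform_measure lborel (cball 0 \<rho>)) = (\<integral>x. g \<rho> x *\<^sub>R f x \<partial>lborel)" if "\<rho> > 0" for \<rho>
    unfolding g_def V_def using em[OF that] V_pos[OF that] by (intro integral_uniform_measure) auto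
  have VV: "V r \<le> V R" unfolding V[OF pos(1)] V[OF pos(2)] using r by (intro mult_left_mono power_mono) auto
  \<comment> \<open>With \<open>v = g R x - g r x\<close>, this is the identity
    \<open>\<bar>v\<bar> = 2 * max 0 (- v) + v\<close>: the negative part lives on the smaller ball.
    In this form the integral is immediate, since both densities have mass 1.\<close>
  define h where "h x = 2 * (indicator (cball 0 r) x * (1 / V r - 1 / V R)) + g R x - g r x" for x :: 'a
  have h: "\<bar>g R x - g r x\<bar> = h x" for x
  proof (cases "x \<in> cball 0 r")
    case True
    then have "x \<in> cball 0 R" using r by auto
    moreover have "1 / V R \<le> 1 / V r" using VV V_pos[OF pos(1)] by (simp add: frac_le)
    ultimately show ?thesis using True by (simp add: g_def h_def)
  next
    case False
    then show ?thesis using V_pos[OF pos(2)] by (simp add: g_def h_def)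
  qed
  have h_int: "integrable lborel h" unfolding h_def using int_ind g_int pos by simp
  have "(\<integral>x. h x \<partial>lborel) = 2 * (1 - V r / V R)"
  proof -
    have "(\<integral>x. g \<rho> x \<partial>lborel) = 1" if "\<rho> > 0" for \<rho>
      using V_pos[OF that] by (simp add: g_def V_def)
    then have "(\<integral>x. h x \<partial>lborel) = 2 * (V r * (1 / V r - 1 / V R))"
      unfolding h_def using int_ind g_int pos by (simp add: V_def)
    also have "V r * (1 / V r - 1 / V R) = 1 - V r / V R"
      using V_pos[OF pos(1)] by (simp add: right_diff_distrib)
    finally show ?thesis .
  qed
  also have "V r / V R = (r / R) ^ DIM('a)"
    using pos unit_ball_vol_pos[of "real DIM('a)"]
    by (simp add: V power_divide less_imp_neq[THEN not_sym])
  finally have h_val: "(\<integral>x. h x \<partial>lborel) \<le> 2 * (DIM('a) * (1 - r / R))"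
    using one_minus_power_le[of "r / R" "DIM('a)"] r pos by simp
  have "B \<ge> 0" using B[of 0] norm_ge_zero[of "f 0"] by linarith
  have "(\<integral>x. g R x *\<^sub>R f x \<partial>lborel) - (\<integral>x. g r x *\<^sub>R f x \<partial>lborel) = (\<integral>x. (g R x - g r x) *\<^sub>R f x \<partial>lborel)"
    using gf_int[OF pos(1)] gf_int[OF pos(2)] by (simp add: scaleR_diff_left)
  also have "norm \<dots> \<le> (\<integral>x. h x * B \<partial>lborel)"
  proof (rule Bochner_Integration.integral_norm_bound_integral)
    show "integrable lborel (\<lambda>x. (g R x - g r x) *\<^sub>R f x)"
      using gf_int[OF pos(1)] gf_int[OF pos(2)] by (simp add: scaleR_diff_left)
    show "integrable lborel (\<lambda>x. h x * B)" using h_int by simp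
    show "norm ((g R x - g r x) *\<^sub>R f x) \<le> h x * B" for x
      using B[of x] by (simp add: h[symmetric] mult_left_mono)
  qed
  also have "\<dots> = (\<integral>x. h x \<partial>lborel) * B" by simp
  also have "\<dots> \<le> 2 * (DIM('a) * (1 - r / R)) * B" by (intro mult_right_mono h_val) fact
  finally show ?thesis using avg pos by (simp add: mult_ac)
qed

lemma (in prob_space) norm_expectation_diff_le:
  fixes f g :: "'a \<Rightarrow> 'b::{banach, second_countable_topology}"
  assumes "integrable M f" "integrable M g" and "AE \<omega> in M. norm (f \<omega> - g \<omega>) \<le> c"
  shows "norm (expectation f - expectation g) \<le> c"
proof -
  have "norm (expectation (\<lambda>\<omega>. f \<omega> - g \<omega>)) \<le> expectation (\<lambda>\<omega>. norm (f \<omega> - g \<omega>))"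
    by (rule integral_norm_bound)
  also have "\<dots> \<le> c" using assms by (intro integral_le_const) auto
  finally show ?thesis using assms by simp
qed

section \<open>Product laws and resampling of independent noise\<close>

text \<open>Independence is assumed between sigma-algebras, so that \<open>X\<close> may be any
  function of the whole past. Measurable rectangles determine the joint law.\<close>

lemma (in prob_space) distr_Pair_of_indep_set:
  assumes indep: "indep_set (sets A) (sets B)"
    and sp: "space A = space M" "space B = space M"
    and X: "X \<in> measurable A S" and Y: "Y \<in> measurable B T"
  shows "distr M S X \<Otimes>\<^sub>M distr M T Y = distr M (S \<Otimes>\<^sub>M T) (\<lambda>\<omega>. (X \<omega>, Y \<omega>))"
proof -
  have "sets A \<subseteq> events" "sets B \<subseteq> events" using indep by (auto simp: indep_sets2_eq)
  then have [measurable]: "X \<in> measurable M S" "Y \<in> measurable M T"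
    using X Y sp by (auto simp: measurable_def)
  interpret S: prob_space "distr M S X" by (rule prob_space_distr) measurable
  interpret T: prob_space "distr M T Y" by (rule prob_space_distr) measurable
  show ?thesis
  proof (rule pair_measure_eqI)
    fix C D assume CD: "C \<in> sets (distr M S X)" "D \<in> sets (distr M T Y)"
    then have [measurable]: "C \<in> sets S" "D \<in> sets T" by auto
    have "X -` C \<inter> space M \<in> sets A" "Y -` D \<inter> space M \<in> sets B"
      using measurable_sets[OF X, of C] measurable_sets[OF Y, of D] sp by auto
    then have "prob ((X -` C \<inter> space M) \<inter> (Y -` D \<inter> space M))
        = prob (X -` C \<inter> space M) * prob (Y -` D \<inter> space M)"
      using indep by (rule indep_setD[rotated])
    moreover have "(X -` C \<inter> space M) \<inter> (Y -` D \<inter> space M) = (\<lambda>\<omega>. (X \<omega>, Y \<omega>)) -` (C \<times> D) \<inter> space M"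
      by auto
    ultimately show "emeasure (distr M S X) C * emeasure (distr M T Y) D
        = emeasure (distr M (S \<Otimes>\<^sub>M T) (\<lambda>\<omega>. (X \<omega>, Y \<omega>))) (C \<times> D)"
      by (simp add: emeasure_distr emeasure_eq_measure ennreal_mult)
  next
    show "sets (distr M S X \<Otimes>\<^sub>M distr M T Y) = sets (distr M (S \<Otimes>\<^sub>M T) (\<lambda>\<omega>. (X \<omega>, Y \<omega>)))"
      unfolding sets_distr by (rule sets_pair_measure_cong) simp_all
  qed (fact S.sigma_finite_measure_axioms T.sigma_finite_measure_axioms)+
qed

lemma (in prob_space) indep_set_sigma_collect:
  assumes indep: "indep_sets E UNIV" and "\<And>i. Int_stable (E i)" and "I \<inter> J = {}"
  shows "indep_set (sets (sigma (space M) (\<Union>i\<in>I. E i))) (sets (sigma (space M) (\<Union>i\<in>J. E i)))"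
proof -
  have "E i \<subseteq> Pow (space M)" for i
    using indep sets.space_closed[of M] by (force simp: indep_sets_def)
  then have sig: "sets (sigma (space M) (\<Union>i\<in>K. E i)) = sigma_sets (space M) (\<Union>i\<in>K. E i)" for K
    by (intro sets_measure_of) blast
  \<comment> \<open>The two disjoint groups become a family indexed by \<open>bool\<close>, the form
    in which \<open>indep_set\<close> is itself defined.\<close>
  have "indep_sets (\<lambda>b. sigma_sets (space M) (\<Union>i\<in>case_bool I J b. E i)) UNIV"
    by (rule indep_sets_collect_sigma)
       (use assms in \<open>auto intro: indep_sets_mono_index[of _ UNIV] simp: disjoint_family_on_def split: bool.splits\<close>)
  then show ?thesis unfolding indep_set_def sig
    by (rule indep_sets_mono_sets) (auto split: bool.splits)
qed

text \<open>Fubini on the joint law. The inner integral, with \<open>Y \<omega>\<close> frozen and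
  \<open>W\<close> drawn anew, takes the place of a conditional expectation given
  \<open>Y\<close>.\<close>

lemma (in prob_space) nn_integral_resample:
  assumes [measurable]: "Y \<in> measurable M S" "W \<in> measurable M T"
    and prod: "distr M S Y \<Otimes>\<^sub>M distr M T W = distr M (S \<Otimes>\<^sub>M T) (\<lambda>\<omega>. (Y \<omega>, W \<omega>))"
    and f [measurable]: "f \<in> borel_measurable (S \<Otimes>\<^sub>M T)"
  shows "(\<integral>\<^sup>+\<omega>. f (Y \<omega>, W \<omega>) \<partial>M) = (\<integral>\<^sup>+\<omega>. \<integral>\<^sup>+\<omega>'. f (Y \<omega>, W \<omega>') \<partial>M \<partial>M)"
proof -
  interpret T: prob_space "distr M T W" by (rule prob_space_distr) measurable
  have "(\<integral>\<^sup>+\<omega>. f (Y \<omega>, W \<omega>) \<partial>M) = (\<integral>\<^sup>+p. f p \<partial>(distr M S Y \<Otimes>\<^sub>M distr M T W))"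
    unfolding prod by (simp add: nn_integral_distr)
  also have "\<dots> = (\<integral>\<^sup>+y. \<integral>\<^sup>+w. f (y, w) \<partial>distr M T W \<partial>distr M S Y)"
    by (rule T.nn_integral_fst[symmetric]) simp
  also have "\<dots> = (\<integral>\<^sup>+\<omega>. \<integral>\<^sup>+\<omega>'. f (Y \<omega>, W \<omega>') \<partial>M \<partial>M)"
    by (subst nn_integral_distr) (auto intro!: nn_integral_cong nn_integral_distr)
  finally show ?thesis .
qed

lemma (in prob_space) integral_resample:
  fixes f :: "'b \<times> 'c \<Rightarrow> real"
  assumes [measurable]: "Y \<in> measurable M S" "W \<in> measurable M T"
    and prod: "distr M S Y \<Otimes>\<^sub>M distr M T W = distr M (S \<Otimes>\<^sub>M T) (\<lambda>\<omega>. (Y \<omega>, W \<omega>))"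
    and f [measurable]: "f \<in> borel_measurable (S \<Otimes>\<^sub>M T)"
    and int: "integrable M (\<lambda>\<omega>. f (Y \<omega>, W \<omega>))"
  shows "(\<integral>\<omega>. f (Y \<omega>, W \<omega>) \<partial>M) = (\<integral>\<omega>. \<integral>\<omega>'. f (Y \<omega>, W \<omega>') \<partial>M \<partial>M)"
proof -
  interpret S: prob_space "distr M S Y" by (rule prob_space_distr) measurable
  interpret T: prob_space "distr M T W" by (rule prob_space_distr) measurable
  interpret ST: pair_sigma_finite "distr M S Y" "distr M T W" ..
  have "integrable (distr M S Y \<Otimes>\<^sub>M distr M T W) f"
    unfolding prod using int by (simp add: integrable_distr_eq)
  then have "(\<integral>y. \<integral>w. f (y, w) \<partial>distr M T W \<partial>distr M S Y) = (\<integral>p. f p \<partial>(distr M S Y \<Otimes>\<^sub>M distr M T W))"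
    using ST.integral_fst'[of f] by simp
  moreover have "(\<integral>p. f p \<partial>(distr M S Y \<Otimes>\<^sub>M distr M T W)) = (\<integral>\<omega>. f (Y \<omega>, W \<omega>) \<partial>M)"
    unfolding prod by (simp add: integral_distr)
  moreover have "(\<integral>y. \<integral>w. f (y, w) \<partial>distr M T W \<partial>distr M S Y) = (\<integral>\<omega>. \<integral>\<omega>'. f (Y \<omega>, W \<omega>') \<partial>M \<partial>M)"
    by (subst integral_distr) (auto intro!: Bochner_Integration.integral_cong integral_distr)
  ultimately show ?thesis by simp
qed

lemma (in finite_measure) integrable_of_square:
  fixes f :: "'a \<Rightarrow> 'b::{banach, second_countable_topology}"
  assumes f [measurable]: "f \<in> borel_measurable M"
    and fin: "(\<integral>\<^sup>+\<omega>. ennreal ((norm (f \<omega>))\<^sup>2) \<partial>M) < \<infinity>"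
  shows "integrable M (\<lambda>\<omega>. (norm (f \<omega>))\<^sup>2)" "integrable M f"
proof -
  show sq: "integrable M (\<lambda>\<omega>. (norm (f \<omega>))\<^sup>2)" using fin by (intro integrableI_bounded) auto
  show "integrable M f"
  proof (rule Bochner_Integration.integrable_bound)
    show "integrable M (\<lambda>\<omega>. 1 + (norm (f \<omega>))\<^sup>2)" using sq by simp
    have "norm v \<le> 1 + (norm v)\<^sup>2" for v :: 'b
      using zero_le_power2[of "norm v - 1"] by (simp add: power2_eq_square algebra_simps)
         (smt (verit) norm_ge_zero)
    then show "AE \<omega> in M. norm (f \<omega>) \<le> norm (1 + (norm (f \<omega>))\<^sup>2)" by simp
  qed measurable
qed

lemma Int_stable_gen_events:
  fixes f :: "'w \<Rightarrow> 'c::topological_space"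
  shows "Int_stable (gen_events M f)"
  unfolding Int_stable_def gen_events_def
proof safe
  fix A B :: "'c set" assume "A \<in> sets borel" "B \<in> sets borel"
  then show "\<exists>D. f -` A \<inter> space M \<inter> (f -` B \<inter> space M) = f -` D \<inter> space M \<and> D \<in> sets borel"
    by (intro exI[of _ "A \<inter> B"]) auto
qed

section \<open>The stochastic approximation scheme\<close>

text \<open>The space is an abstract Euclidean one. Coordinates matter only for the Jacobian, which
  has already been turned into a Lipschitz bound when it reaches this setting.\<close>

locale rssa = prob_space M
  for M :: "'w measure" +
  fixes X Xe :: "'a::euclidean_space set"
    and \<Phi> :: "'a \<Rightarrow> 'b::euclidean_space \<Rightarrow> 'a"
    and F :: "'a \<Rightarrow> 'a"
    and \<xi> :: "'w \<Rightarrow> 'b" and \<xi>s :: "nat \<Rightarrow> 'w \<Rightarrow> 'b"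
    and z x :: "nat \<Rightarrow> 'w \<Rightarrow> 'a"
    and \<gamma> \<eta> \<epsilon>s :: "nat \<Rightarrow> real"
    and \<epsilon> C :: real
    and s :: "nat \<Rightarrow> 'a"
  assumes X: "compact X" "convex X" "X \<noteq> {}"
    and \<epsilon>: "\<epsilon> > 0"
    and Xe: "Xe = enlargement X \<epsilon>"
    and \<Phi>_meas: "case_prod \<Phi> \<in> borel_measurable (restrict_space borel Xe \<Otimes>\<^sub>M borel)"
    and \<xi>_rv [measurable]: "\<xi> \<in> borel_measurable M"
    and F: "F = mean_map M \<xi> Xe \<Phi>"
    and F_mono: "monotone_map_on Xe F"
    and F_cont: "continuous_on Xe F"
    and moment_int: "\<And>y. y \<in> Xe \<Longrightarrow> integrable M (\<lambda>\<omega>. (norm (\<Phi> y (\<xi> \<omega>)))\<^sup>2)"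
    and moment: "\<And>y. y \<in> Xe \<Longrightarrow> (\<integral>\<omega>. (norm (\<Phi> y (\<xi> \<omega>)))\<^sup>2 \<partial>M) \<le> C\<^sup>2"
    and \<xi>s_rv [measurable]: "\<And>k. \<xi>s k \<in> borel_measurable M"
    and \<xi>s_copy: "\<And>k. distr M borel (\<xi>s k) = distr M borel \<xi>"
    and z_rv [measurable]: "\<And>k. z k \<in> borel_measurable M"
    and z_unif: "\<And>k. distr M borel (z k) = uniform_measure lborel (cball 0 (\<epsilon>s k))"
    and x0_rv [measurable]: "x 0 \<in> borel_measurable M"
    and x0_in: "\<And>\<omega>. \<omega> \<in> space M \<Longrightarrow> x 0 \<omega> \<in> X"
    and indep: "mutually_independent M (x 0) \<xi>s z"
    and \<gamma>_pos: "\<And>k. \<gamma> k > 0" and \<eta>_pos: "\<And>k. \<eta> k > 0" and \<epsilon>s_pos: "\<And>k. \<epsilon>s k > 0"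
    and \<gamma>_lim: "\<gamma> \<longlonglongrightarrow> 0" and \<eta>_lim: "\<eta> \<longlonglongrightarrow> 0" and \<epsilon>s_lim: "\<epsilon>s \<longlonglongrightarrow> 0"
    and \<epsilon>s_le: "\<And>k. \<epsilon>s k \<le> \<epsilon>"
    and step_div: "filterlim (\<lambda>m. \<Sum>k<m. \<gamma> k * \<eta> k) at_top sequentially"
    and \<gamma>_summable: "summable (\<lambda>k. (\<gamma> k)\<^sup>2)"
    and \<epsilon>s_summable: "summable (\<lambda>k. 1 / ((\<eta> k)\<^sup>2 * \<eta> (Suc k) * \<gamma> (Suc k)) *
              (1 - min (\<epsilon>s (Suc k)) (\<epsilon>s k) / max (\<epsilon>s (Suc k)) (\<epsilon>s k))\<^sup>2)"
    and \<eta>_summable: "summable (\<lambda>k. 1 / (\<eta> (Suc k) * \<gamma> (Suc k)) * (1 - \<eta> (Suc k) / \<eta> k)\<^sup>2)"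
    and scheme: "\<And>k \<omega>. \<omega> \<in> space M \<Longrightarrow>
          x (Suc k) \<omega> = closest_point X
            (x k \<omega> - \<gamma> k *\<^sub>R (\<Phi> (x k \<omega> + z k \<omega>) (\<xi>s k \<omega>) + \<eta> k *\<^sub>R x k \<omega>))"
    and s: "\<And>k. s k = (THE y. y \<in> VI_solutions X (\<lambda>y. smoothed_map M (z k) F y + \<eta> k *\<^sub>R y))"
begin

subsection \<open>The smoothed mappings and their solutions\<close>

abbreviation Fs :: "nat \<Rightarrow> 'a \<Rightarrow> 'a" where "Fs k \<equiv> smoothed_map M (z k) F"

lemma X_closed: "closed X" using X(1) by (rule compact_imp_closed)

lemma Xe_compact: "compact Xe" unfolding Xe by (rule compact_enlargement) (fact X(1))

lemma X_sub_Xe: "y \<in> X \<Longrightarrow> y \<in> Xe"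
  using mem_enlargement[of y X 0 \<epsilon>] \<epsilon> unfolding Xe by simp

lemma shift_mem_Xe: "y \<in> X \<Longrightarrow> norm u \<le> \<epsilon>s k \<Longrightarrow> y + u \<in> Xe"
  using mem_enlargement[of y X u \<epsilon>] \<epsilon>s_le[of k] unfolding Xe by simp

lemma Xe_sets [measurable]: "Xe \<in> sets borel"
  using compact_imp_closed[OF Xe_compact] by (rule borel_closed)

lemma F_zero: "y \<notin> Xe \<Longrightarrow> F y = 0" unfolding F mean_map_def by simp

lemma F_measurable [measurable]: "F \<in> borel_measurable borel"
proof -
  have "(\<lambda>y. if y \<in> Xe then F y else 0) \<in> borel_measurable borel"
    by (intro borel_measurable_continuous_on_if F_cont) auto
  also have "(\<lambda>y. if y \<in> Xe then F y else 0) = F" using F_zero by auto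
  finally show ?thesis .
qed

text \<open>Compactness of \<open>Xe\<close> bounds the continuous part; the value 0 elsewhere
  extends the bound to shifts that leave \<open>Xe\<close>.\<close>

lemma F_bounded: obtains B where "B > 0" "\<And>y. norm (F y) \<le> B"
proof -
  have "bounded (F ` Xe)"
    using compact_continuous_image[OF F_cont Xe_compact] by (rule compact_imp_bounded)
  then obtain B where "B > 0" "\<And>y. y \<in> Xe \<Longrightarrow> norm (F y) \<le> B" by (auto simp: bounded_pos)
  then have "norm (F y) \<le> B" for y using F_zero[of y] by (cases "y \<in> Xe") auto
  with \<open>B > 0\<close> show thesis using that by blast
qed

lemma z_AE: "AE \<omega> in M. norm (z k \<omega>) \<le> \<epsilon>s k"
proof -
  have "AE u in distr M borel (z k). norm u \<le> \<epsilon>s k"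
    unfolding z_unif by (rule AE_uniform_measureI) auto
  then show ?thesis by (subst (asm) AE_distr_iff) auto
qed

lemma F_shift_integrable: "integrable M (\<lambda>\<omega>. F (y + z k \<omega>))"
proof -
  obtain B where "\<And>y. norm (F y) \<le> B" using F_bounded by blast
  then show ?thesis by (intro integrable_const_bound[of _ B]) auto
qed

lemma Fs_eq: "Fs k y = (\<integral>u. F (y + u) \<partial>uniform_measure lborel (cball 0 (\<epsilon>s k)))"
  unfolding z_unif[symmetric] smoothed_map_def by (simp add: integral_distr)

lemma norm_Fs_diff_le:
  assumes "\<And>u. norm u \<le> \<epsilon>s k \<Longrightarrow> norm (F (y + u) - F (w + u)) \<le> c"
  shows "norm (Fs k y - Fs k w) \<le> c"
  unfolding smoothed_map_def
  by (rule norm_expectation_diff_le[OF F_shift_integrable F_shift_integrable])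
     (use z_AE[of k] assms in auto)

lemma norm_Fs_minus_F_le:
  assumes "\<And>u. norm u \<le> \<epsilon>s k \<Longrightarrow> norm (F (y + u) - F w) \<le> c"
  shows "norm (Fs k y - F w) \<le> c"
proof -
  have "norm (Fs k y - expectation (\<lambda>_. F w)) \<le> c"
    unfolding smoothed_map_def
    by (rule norm_expectation_diff_le[OF F_shift_integrable]) (use z_AE[of k] assms in auto)
  then show ?thesis by (simp add: prob_space)
qed

lemma F_uniformly_continuous:
  assumes "e > 0"
  obtains d where "d > 0" "\<And>y w. y \<in> Xe \<Longrightarrow> w \<in> Xe \<Longrightarrow> norm (y - w) < d \<Longrightarrow> norm (F y - F w) \<le> e"
proof -
  from compact_uniformly_continuous[OF F_cont Xe_compact] assms
  obtain d where "d > 0" "\<And>y w. y \<in> Xe \<Longrightarrow> w \<in> Xe \<Longrightarrow> dist w y < d \<Longrightarrow> dist (F w) (F y) < e"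
    unfolding uniformly_continuous_on_def by metis
  then show thesis using that by (metis dist_norm less_imp_le)
qed

lemma Fs_continuous: "continuous_on X (Fs k)"
  unfolding continuous_on_iff
proof (intro ballI allI impI)
  fix v :: 'a and e :: real assume v: "v \<in> X" and e: "0 < e"
  \<comment> \<open>Uniform continuity is essential: one \<open>d\<close> has to serve all shifts
    \<open>u\<close> at once.\<close>
  obtain d where d: "d > 0" "\<And>y w. y \<in> Xe \<Longrightarrow> w \<in> Xe \<Longrightarrow> norm (y - w) < d \<Longrightarrow> norm (F y - F w) \<le> e / 2"
    using F_uniformly_continuous[of "e / 2"] e by auto
  have "dist (Fs k w) (Fs k v) < e" if "w \<in> X" "dist w v < d" for w
  proof -
    have "norm (Fs k w - Fs k v) \<le> e / 2"
      using that v by (intro norm_Fs_diff_le d(2)) (auto intro: shift_mem_Xe simp: dist_norm)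
    then show ?thesis using e by (simp add: dist_norm)
  qed
  with d(1) show "\<exists>d>0. \<forall>w\<in>X. dist w v < d \<longrightarrow> dist (Fs k w) (Fs k v) < e" by blast
qed

text \<open>Both arguments receive the same shift, which cancels in their difference, so
  monotonicity of \<open>F\<close> can be averaged over \<open>z k\<close>.\<close>

lemma Fs_monotone: "monotone_map_on X (Fs k)"
  unfolding monotone_map_on_def
proof (intro ballI)
  fix y w assume yw: "y \<in> X" "w \<in> X"
  have "Fs k y - Fs k w = expectation (\<lambda>\<omega>. F (y + z k \<omega>) - F (w + z k \<omega>))"
    unfolding smoothed_map_def using F_shift_integrable by simp
  then have "(Fs k y - Fs k w) \<bullet> (y - w)
      = expectation (\<lambda>\<omega>. (F (y + z k \<omega>) - F (w + z k \<omega>)) \<bullet> (y - w))"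
    using F_shift_integrable by simp
  also have "\<dots> \<ge> 0"
  proof (rule integral_nonneg_AE)
    show "AE \<omega> in M. 0 \<le> (F (y + z k \<omega>) - F (w + z k \<omega>)) \<bullet> (y - w)"
      using z_AE[of k]
    proof (rule AE_mp, intro AE_I2 impI)
      fix \<omega> assume "norm (z k \<omega>) \<le> \<epsilon>s k"
      then have "y + z k \<omega> \<in> Xe" "w + z k \<omega> \<in> Xe" using yw shift_mem_Xe by auto
      with F_mono show "0 \<le> (F (y + z k \<omega>) - F (w + z k \<omega>)) \<bullet> (y - w)"
        unfolding monotone_map_on_def by force
    qed
  qed
  finally show "0 \<le> (Fs k y - Fs k w) \<bullet> (y - w)" .
qed

lemma s_solution: "s k \<in> VI_solutions X (\<lambda>y. Fs k y + \<eta> k *\<^sub>R y)"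
  unfolding s by (rule the_VI_solution[OF X Fs_continuous Fs_monotone \<eta>_pos])

lemma s_mem: "s k \<in> X" using s_solution by (auto simp: VI_solutions_def)

lemma s_ineq: "y \<in> X \<Longrightarrow> (Fs k (s k) + \<eta> k *\<^sub>R s k) \<bullet> (y - s k) \<ge> 0"
  using s_solution by (auto simp: VI_solutions_def)

text \<open>The base point and the smoothing radius vary together; half of the modulus
  \<open>d\<close> is allotted to each.\<close>

lemma Fs_tendsto:
  assumes q: "\<And>n. q n \<in> X" "q \<longlonglongrightarrow> l" and r: "filterlim r at_top sequentially"
  shows "(\<lambda>n. Fs (r n) (q n)) \<longlonglongrightarrow> F l"
proof (rule LIMSEQ_I)
  fix e :: real assume e: "e > 0"
  obtain d where d: "d > 0" "\<And>y w. y \<in> Xe \<Longrightarrow> w \<in> Xe \<Longrightarrow> norm (y - w) < d \<Longrightarrow> norm (F y - F w) \<le> e / 2"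
    using F_uniformly_continuous[of "e / 2"] e by auto
  have l: "l \<in> Xe" by (rule X_sub_Xe[OF closed_sequentially[OF X_closed _ q(2)]]) (rule q(1))
  have "\<forall>\<^sub>F n in sequentially. norm (q n - l) < d / 2"
    using tendstoD[OF q(2), of "d / 2"] d(1) by (simp add: dist_norm)
  moreover have "\<forall>\<^sub>F n in sequentially. \<epsilon>s (r n) < d / 2"
    using filterlim_compose[OF \<epsilon>s_lim r] d(1) by (intro order_tendstoD) auto
  ultimately have "\<forall>\<^sub>F n in sequentially. norm (Fs (r n) (q n) - F l) < e"
  proof eventually_elim
    case (elim n)
    have "norm (Fs (r n) (q n) - F l) \<le> e / 2"
    proof (rule norm_Fs_minus_F_le, rule d(2)[OF _ l])
      fix u :: 'a assume u: "norm u \<le> \<epsilon>s (r n)"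
      then show "q n + u \<in> Xe" using q(1) shift_mem_Xe by blast
      have "norm (q n + u - l) \<le> norm (q n - l) + norm u"
        using norm_triangle_ineq[of "q n - l" u] by (simp add: algebra_simps)
      then show "norm (q n + u - l) < d" using elim u by simp
    qed
    then show ?case using e by simp
  qed
  then show "\<exists>N. \<forall>n\<ge>N. norm (Fs (r n) (q n) - F l) < e" by (simp add: eventually_sequentially)
qed

lemma s_limit_point:
  assumes r: "filterlim r at_top sequentially" and l: "(\<lambda>n. s (r n)) \<longlonglongrightarrow> l"
  shows "l \<in> VI_solutions X F"
proof -
  have "l \<in> X" by (rule closed_sequentially[OF X_closed _ l]) (rule s_mem)
  moreover have "F l \<bullet> (y - l) \<ge> 0" if "y \<in> X" for y
  proof (rule LIMSEQ_le_const)
    have "(\<lambda>n. (Fs (r n) (s (r n)) + \<eta> (r n) *\<^sub>R s (r n)) \<bullet> (y - s (r n))) \<longlonglongrightarrow> (F l + 0 *\<^sub>R l) \<bullet> (y - l)"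
      by (intro tendsto_intros Fs_tendsto l filterlim_compose[OF \<eta>_lim r] s_mem r)
    then show "(\<lambda>n. (Fs (r n) (s (r n)) + \<eta> (r n) *\<^sub>R s (r n)) \<bullet> (y - s (r n))) \<longlonglongrightarrow> F l \<bullet> (y - l)"
      by simp
  qed (use s_ineq[OF that] in auto)
  ultimately show ?thesis by (auto simp: VI_solutions_def)
qed

lemma X_bound: obtains R where "R > 0" "\<And>y. y \<in> X \<Longrightarrow> norm y \<le> R"
  using compact_imp_bounded[OF X(1)] by (auto simp: bounded_pos)

text \<open>The perturbation lemma with the mappings of two successive indices. \<open>R\<close>
  bounds \<open>X\<close>, and \<open>D\<close> is the constant of the ball comparison.\<close>

lemma s_drift:
  obtains R D where "R > 0" "D > 0"
    "\<And>k. norm (s (Suc k) - s k) \<le> R * \<bar>1 - \<eta> (Suc k) / \<eta> k\<bar>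
      + D / \<eta> k * (1 - min (\<epsilon>s (Suc k)) (\<epsilon>s k) / max (\<epsilon>s (Suc k)) (\<epsilon>s k))"
proof -
  obtain R where R: "R > 0" "\<And>y. y \<in> X \<Longrightarrow> norm y \<le> R" using X_bound by blast
  obtain B where B: "B > 0" "\<And>y. norm (F y) \<le> B" using F_bounded by blast
  define D where "D = 2 * B * DIM('a)"
  have "norm (Fs (Suc k) y - Fs k y) \<le> D * (1 - min (\<epsilon>s (Suc k)) (\<epsilon>s k) / max (\<epsilon>s (Suc k)) (\<epsilon>s k))" for k y
  proof (cases "\<epsilon>s k \<le> \<epsilon>s (Suc k)")
    case True
    then show ?thesis
      using norm_integral_uniform_ball_diff_le[OF \<epsilon>s_pos True, of "\<lambda>u. F (y + u)" B] B
      unfolding Fs_eq D_def by (simp add: min_def max_def)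
  next
    case False
    then have le: "\<epsilon>s (Suc k) \<le> \<epsilon>s k" by simp
    then show ?thesis
      using norm_integral_uniform_ball_diff_le[OF \<epsilon>s_pos le, of "\<lambda>u. F (y + u)" B] B False
      unfolding Fs_eq D_def by (simp add: min_def max_def norm_minus_commute)
  qed
  then have "norm (s (Suc k) - s k) \<le> R * \<bar>1 - \<eta> (Suc k) / \<eta> k\<bar>
      + D * (1 - min (\<epsilon>s (Suc k)) (\<epsilon>s k) / max (\<epsilon>s (Suc k)) (\<epsilon>s k)) / \<eta> k" for k
    by (intro VI_solution_perturbation[OF Fs_monotone \<eta>_pos s_solution s_solution] R s_mem)
  moreover have "D > 0" using B by (simp add: D_def)
  ultimately show thesis using that R(1) by simp
qed

text \<open>The square of the two-term drift bound, divided by \<open>\<gamma> * \<eta>\<close>, is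
  at most a combination of the summands of conditions (g) and (f), here \<open>a\<close> and
  \<open>b\<close>.\<close>

lemma s_drift_summable: "summable (\<lambda>k. (norm (s (Suc k) - s k))\<^sup>2 / (\<gamma> (Suc k) * \<eta> (Suc k)))"
proof -
  obtain R D where R: "R > 0" and D: "D > 0"
    and drift: "\<And>k. norm (s (Suc k) - s k) \<le> R * \<bar>1 - \<eta> (Suc k) / \<eta> k\<bar>
      + D / \<eta> k * (1 - min (\<epsilon>s (Suc k)) (\<epsilon>s k) / max (\<epsilon>s (Suc k)) (\<epsilon>s k))"
    using s_drift by blast
  define a where "a k = 1 / (\<eta> (Suc k) * \<gamma> (Suc k)) * (1 - \<eta> (Suc k) / \<eta> k)\<^sup>2" for k
  define q where "q k = 1 - min (\<epsilon>s (Suc k)) (\<epsilon>s k) / max (\<epsilon>s (Suc k)) (\<epsilon>s k)" for k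
  define b where "b k = 1 / ((\<eta> k)\<^sup>2 * \<eta> (Suc k) * \<gamma> (Suc k)) * (q k)\<^sup>2" for k
  have "summable (\<lambda>k. 2 * R\<^sup>2 * a k + 2 * D\<^sup>2 * b k)"
    using \<eta>_summable \<epsilon>s_summable unfolding a_def b_def q_def
    by (intro summable_add summable_mult)
  then show ?thesis
  proof (rule summable_comparison_test_ev[rotated], intro always_eventually allI)
    fix k
    have "(norm (s (Suc k) - s k))\<^sup>2 \<le> (R * \<bar>1 - \<eta> (Suc k) / \<eta> k\<bar> + D / \<eta> k * q k)\<^sup>2"
      using drift[of k] unfolding q_def by (intro power_mono) auto
    also have "\<dots> \<le> 2 * (R * \<bar>1 - \<eta> (Suc k) / \<eta> k\<bar>)\<^sup>2 + 2 * (D / \<eta> k * q k)\<^sup>2"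
      by (rule square_add_le)
    finally have "(norm (s (Suc k) - s k))\<^sup>2 / (\<gamma> (Suc k) * \<eta> (Suc k))
        \<le> (2 * (R * \<bar>1 - \<eta> (Suc k) / \<eta> k\<bar>)\<^sup>2 + 2 * (D / \<eta> k * q k)\<^sup>2) / (\<gamma> (Suc k) * \<eta> (Suc k))"
      using \<gamma>_pos[of "Suc k"] \<eta>_pos[of "Suc k"] by (intro divide_right_mono) auto
    also have "\<dots> = 2 * R\<^sup>2 * a k + 2 * D\<^sup>2 * b k"
      unfolding a_def b_def
      by (simp add: power_mult_distrib power_divide add_divide_distrib mult_ac)
    finally show "norm ((norm (s (Suc k) - s k))\<^sup>2 / (\<gamma> (Suc k) * \<eta> (Suc k)))
        \<le> 2 * R\<^sup>2 * a k + 2 * D\<^sup>2 * b k"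
      using \<gamma>_pos[of "Suc k"] \<eta>_pos[of "Suc k"] by (simp add: abs_mult)
  qed
qed

text \<open>When \<open>s k\<close> and \<open>t\<close> are tested against each other, monotonicity
  of \<open>Fs k\<close> leaves only the smoothing bias \<open>Fs k t - F t\<close>. It is taken at
  \<open>t\<close> alone, which is why a Lipschitz bound near \<open>t\<close> suffices.\<close>

lemma s_tendsto:
  assumes ratio: "(\<lambda>k. \<epsilon>s k / \<eta> k) \<longlonglongrightarrow> 0"
    and t: "t \<in> VI_solutions X F" "\<And>w. w \<in> VI_solutions X F \<Longrightarrow> norm t \<le> norm w"
    and r: "r > 0" and lip: "\<And>y. y \<in> ball t r \<Longrightarrow> norm (F y - F t) \<le> L * norm (y - t)"
    and L: "L \<ge> 0"
  shows "s \<longlonglongrightarrow> t"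
proof -
  obtain R where R: "R > 0" "\<And>y. y \<in> X \<Longrightarrow> norm y \<le> R" using X_bound by blast
  have tX: "t \<in> X" using t by (auto simp: VI_solutions_def)
  define c where "c k = L * (\<epsilon>s k / \<eta> k) * (2 * R)" for k
  have "(\<lambda>k. L * (\<epsilon>s k / \<eta> k) * (2 * R)) \<longlonglongrightarrow> L * 0 * (2 * R)" by (intro tendsto_intros ratio)
  then have c_lim: "c \<longlonglongrightarrow> 0" by (simp add: c_def[abs_def])
  have "\<forall>\<^sub>F k in sequentially. \<epsilon>s k < r" using \<epsilon>s_lim r by (intro order_tendstoD) auto
  then have ineq: "\<forall>\<^sub>F k in sequentially. s k \<bullet> (s k - t) \<le> c k"
  proof eventually_elim
    case (elim k)
    have Ft: "norm (Fs k t - F t) \<le> L * \<epsilon>s k"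
    proof (rule norm_Fs_minus_F_le)
      fix u :: 'a assume u: "norm u \<le> \<epsilon>s k"
      then have "norm (F (t + u) - F t) \<le> L * norm u"
        using lip[of "t + u"] elim by (simp add: dist_norm)
      also have "\<dots> \<le> L * \<epsilon>s k" using u L by (intro mult_left_mono)
      finally show "norm (F (t + u) - F t) \<le> L * \<epsilon>s k" .
    qed
    have "norm (t - s k) \<le> 2 * R"
      using norm_triangle_ineq4[of t "s k"] R(2)[OF tX] R(2)[OF s_mem[of k]] by linarith
    have 1: "(Fs k (s k) + \<eta> k *\<^sub>R s k) \<bullet> (t - s k) \<ge> 0" by (rule s_ineq[OF tX])
    have 2: "F t \<bullet> (s k - t) \<ge> 0" using t(1) s_mem by (auto simp: VI_solutions_def)
    have 3: "(Fs k (s k) - Fs k t) \<bullet> (s k - t) \<ge> 0"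
      using Fs_monotone s_mem tX by (auto simp: monotone_map_on_def)
    have "\<eta> k * (s k \<bullet> (s k - t)) \<le> (Fs k t - F t) \<bullet> (t - s k)"
      using 1 2 3 by (simp add: inner_simps algebra_simps)
    also have "\<dots> \<le> norm (Fs k t - F t) * norm (t - s k)" by (rule norm_cauchy_schwarz)
    also have "\<dots> \<le> (L * \<epsilon>s k) * (2 * R)"
      using Ft \<open>norm (t - s k) \<le> 2 * R\<close> L \<epsilon>s_pos[of k] by (intro mult_mono) auto
    finally show ?case using \<eta>_pos[of k] by (simp add: c_def field_simps)
  qed
  show ?thesis
  proof (rule ccontr)
    assume "\<not> s \<longlonglongrightarrow> t"
    then obtain e where e: "e > 0" "\<exists>\<^sub>F k in sequentially. e \<le> dist (s k) t"
      unfolding tendsto_iff by (auto simp: frequently_def not_le)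
    then have "infinite {k. e \<le> dist (s k) t}"
      by (simp add: frequently_cofinite cofinite_eq_sequentially[symmetric])
    then obtain p :: "nat \<Rightarrow> nat" where p: "strict_mono p" "\<And>n. e \<le> dist (s (p n)) t"
      using infinite_enumerate by blast
    have "seq_compact X" using X(1) compact_imp_seq_compact by blast
    then obtain l p' where l: "l \<in> X" and p': "strict_mono p'" "((\<lambda>n. s (p n)) \<circ> p') \<longlonglongrightarrow> l"
      using s_mem unfolding seq_compact_def by (metis (no_types, lifting))
    define r' where "r' = p \<circ> p'"
    have r': "filterlim r' at_top sequentially"
      unfolding r'_def using p(1) p'(1) by (intro filterlim_subseq strict_mono_o)
    have lim: "(\<lambda>n. s (r' n)) \<longlonglongrightarrow> l" using p'(2) by (simp add: r'_def o_def)
    have "l \<bullet> (l - t) \<le> 0"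
    proof (rule tendsto_le[OF sequentially_bot])
      show "(\<lambda>n. s (r' n) \<bullet> (s (r' n) - t)) \<longlonglongrightarrow> l \<bullet> (l - t)" by (intro tendsto_intros lim)
      show "(\<lambda>n. c (r' n)) \<longlonglongrightarrow> 0" by (rule filterlim_compose[OF c_lim r'])
      show "\<forall>\<^sub>F n in sequentially. s (r' n) \<bullet> (s (r' n) - t) \<le> c (r' n)"
        using filterlim_iff[THEN iffD1, OF r'] ineq by auto
    qed
    moreover have "norm t \<le> norm l" by (rule t(2)) (rule s_limit_point[OF r' lim])
    then have "t \<bullet> t \<le> l \<bullet> l" by (simp add: norm_le)
    \<comment> \<open>The left side equals
      \<open>2 * (l \<bullet> (l - t)) + t \<bullet> t - l \<bullet> l\<close>, and both
      contributions are nonpositive.\<close>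
    ultimately have "(l - t) \<bullet> (l - t) \<le> 0" by (simp add: inner_simps inner_commute)
    then have "l = t" by (metis eq_iff_diff_eq_0 inner_eq_zero_iff inner_ge_zero order_antisym)
    with lim have "\<forall>\<^sub>F n in sequentially. dist (s (r' n)) t < e" using e(1) by (intro tendstoD) auto
    then obtain n where "dist (s (r' n)) t < e" using eventually_happens sequentially_bot by blast
    with p(2)[of "p' n"] show False by (simp add: r'_def)
  qed
qed

subsection \<open>A measurable version of the iterates\<close>

text \<open>Off \<open>Xe\<close> the values of \<open>\<Phi>\<close> need not be measurable, and then neither are the iterates, since
  \<open>z k\<close> may leave its ball on a null set. The iterates are therefore replaced by ones driven by
  the truncation of \<open>\<Phi>\<close>, which agree with them almost surely.\<close>

definition \<Phi>0 :: "'a \<Rightarrow> 'b \<Rightarrow> 'a" where "\<Phi>0 y e = (if y \<in> Xe then \<Phi> y e else 0)"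

primrec y :: "nat \<Rightarrow> 'w \<Rightarrow> 'a" where
  "y 0 \<omega> = x 0 \<omega>"
| "y (Suc k) \<omega> = closest_point X (y k \<omega> - \<gamma> k *\<^sub>R (\<Phi>0 (y k \<omega> + z k \<omega>) (\<xi>s k \<omega>) + \<eta> k *\<^sub>R y k \<omega>))"

definition g :: "nat \<Rightarrow> 'w \<Rightarrow> 'a" where "g k \<omega> = \<Phi>0 (y k \<omega> + z k \<omega>) (\<xi>s k \<omega>)"

lemma y_mem: "\<omega> \<in> space M \<Longrightarrow> y k \<omega> \<in> X"
  by (cases k) (auto simp: x0_in closest_point_in_set[OF X_closed X(3)])

lemma x_eq_y: "AE \<omega> in M. \<forall>k. x k \<omega> = y k \<omega>"
proof -
  have "AE \<omega> in M. \<forall>k. norm (z k \<omega>) \<le> \<epsilon>s k" by (simp add: AE_all_countable z_AE)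
  then show ?thesis
  proof (rule AE_mp, intro AE_I2 impI allI)
    fix \<omega> k assume \<omega>: "\<omega> \<in> space M" "\<forall>k. norm (z k \<omega>) \<le> \<epsilon>s k"
    show "x k \<omega> = y k \<omega>"
    proof (induction k)
      case (Suc k)
      have "y k \<omega> + z k \<omega> \<in> Xe" using \<omega> y_mem shift_mem_Xe by blast
      then show ?case using Suc \<omega> by (simp add: scheme \<Phi>0_def)
    qed simp
  qed
qed

lemma \<Phi>0_measurable: "(\<lambda>p. \<Phi>0 (fst p) (snd p)) \<in> borel_measurable (borel \<Otimes>\<^sub>M borel)"
proof -
  let ?R = "restrict_space (borel \<Otimes>\<^sub>M borel) (Xe \<times> UNIV) :: ('a \<times> 'b) measure"
  \<comment> \<open>Measurability is given on a product with a restricted factor; moving it to the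
    restriction of the full product allows extension by 0.\<close>
  have "(\<lambda>p. (fst p, snd p)) \<in> measurable ?R (restrict_space borel Xe \<Otimes>\<^sub>M borel)"
    by (intro measurable_Pair measurable_restrict_space2 measurable_restrict_space1)
       (auto simp: space_restrict_space)
  from measurable_compose[OF this \<Phi>_meas]
  have "(\<lambda>p. case_prod \<Phi> p) \<in> borel_measurable ?R" by simp
  then have "(\<lambda>p. if p \<in> Xe \<times> UNIV then case_prod \<Phi> p else 0) \<in> borel_measurable (borel \<Otimes>\<^sub>M borel)"
    by (subst (asm) measurable_restrict_space_iff[where c = 0]) (auto simp: space_pair_measure intro!: pair_measureI)
  also have "(\<lambda>p. if p \<in> Xe \<times> UNIV then case_prod \<Phi> p else 0) = (\<lambda>p. \<Phi>0 (fst p) (snd p))"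
    by (auto simp: \<Phi>0_def)
  finally show ?thesis .
qed

lemma \<Phi>0_compose [measurable (raw)]:
  assumes "f \<in> borel_measurable N" "h \<in> borel_measurable N"
  shows "(\<lambda>\<omega>. \<Phi>0 (f \<omega>) (h \<omega>)) \<in> borel_measurable N"
  using measurable_compose[OF measurable_Pair[OF assms] \<Phi>0_measurable] by simp

lemma closest_point_measurable [measurable]: "closest_point X \<in> borel_measurable borel"
  using continuous_on_closest_point[OF X(2) X_closed X(3)] by (rule borel_measurable_continuous_onI)

section \<open>Sigma-algebras generated by groups of the random inputs\<close>

definition E :: "rv_index \<Rightarrow> 'w set set" where
  "E i = (case i of Init \<Rightarrow> gen_events M (x 0)
                  | Sample j \<Rightarrow> gen_events M (\<xi>s j)
                  | Perturb j \<Rightarrow> gen_events M (z j))"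

definition events_of :: "rv_index set \<Rightarrow> 'w measure" where
  "events_of I = sigma (space M) (\<Union>i\<in>I. E i)"

text \<open>The inputs on which \<open>y k\<close> depends. Index \<open>k\<close> is excluded,
  because the noise of step \<open>k\<close> first enters \<open>y (Suc k)\<close>.\<close>

definition past :: "nat \<Rightarrow> rv_index set" where
  "past k = insert Init (Sample ` {..<k} \<union> Perturb ` {..<k})"

lemma E_indep: "indep_sets E UNIV"
  using indep unfolding mutually_independent_def E_def .

lemma E_events: "E i \<subseteq> events"
  using E_indep by (auto simp: indep_sets_def)

lemma E_Int_stable: "Int_stable (E i)"
  by (cases i) (simp_all add: E_def Int_stable_gen_events)

lemma space_events_of [simp]: "space (events_of I) = space M"
  unfolding events_of_def using E_events sets.space_closed[of M] by (intro space_measure_of) blast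

lemma sets_events_of: "sets (events_of I) = sigma_sets (space M) (\<Union>i\<in>I. E i)"
  unfolding events_of_def using E_events sets.space_closed[of M] by (intro sets_measure_of) blast

lemma events_of_subset: "sets (events_of I) \<subseteq> events"
  unfolding sets_events_of using E_events by (intro sets.sigma_sets_subset) blast

lemma events_of_mono: "I \<subseteq> J \<Longrightarrow> sets (events_of I) \<subseteq> sets (events_of J)"
  unfolding sets_events_of by (intro sigma_sets_mono') blast

text \<open>The variable is tied to its index by an equation of event families, as the inputs take
  values in different types.\<close>

lemma measurable_events_of:
  assumes "gen_events M f = E i" "i \<in> I"
  shows "f \<in> borel_measurable (events_of I)"
proof (rule measurableI)
  fix A assume "A \<in> sets (borel :: 'c::topological_space measure)"
  then have "f -` A \<inter> space M \<in> E i" using assms(1) by (auto simp: gen_events_def)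
  then show "f -` A \<inter> space (events_of I) \<in> sets (events_of I)"
    using assms(2) by (auto simp: sets_events_of)
qed simp

text \<open>Allowing every later \<open>j\<close> keeps the sigma-algebra fixed while the induction
  advances \<open>k\<close>.\<close>

lemma y_measurable_past: "k \<le> j \<Longrightarrow> y k \<in> borel_measurable (events_of (past j))"
proof (induction k)
  case 0
  have "x 0 \<in> borel_measurable (events_of (past j))"
    by (rule measurable_events_of[of _ Init]) (auto simp: E_def past_def)
  then show ?case by simp
next
  case (Suc k)
  have [measurable]: "\<xi>s k \<in> borel_measurable (events_of (past j))"
    by (rule measurable_events_of[of _ "Sample k"]) (use Suc in \<open>auto simp: E_def past_def\<close>)
  have [measurable]: "z k \<in> borel_measurable (events_of (past j))"
    by (rule measurable_events_of[of _ "Perturb k"]) (use Suc in \<open>auto simp: E_def past_def\<close>)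
  have [measurable]: "y k \<in> borel_measurable (events_of (past j))" using Suc by simp
  show ?case by simp
qed

lemma y_measurable [measurable]: "y k \<in> borel_measurable M"
  using y_measurable_past[of k k] events_of_subset[of "past k"] by (auto simp: measurable_def)

lemma g_measurable [measurable]: "g k \<in> borel_measurable M"
  unfolding g_def by measurable

subsection \<open>Moments of the noise given the past\<close>

lemma distr_sample_perturb:
  "distr M borel (z k) \<Otimes>\<^sub>M distr M borel (\<xi>s k) = distr M (borel \<Otimes>\<^sub>M borel) (\<lambda>\<omega>. (z k \<omega>, \<xi>s k \<omega>))"
proof (rule distr_Pair_of_indep_set)
  show "indep_set (sets (events_of {Perturb k})) (sets (events_of {Sample k}))"
    unfolding events_of_def by (rule indep_set_sigma_collect[OF E_indep E_Int_stable]) simp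
  show "z k \<in> borel_measurable (events_of {Perturb k})" "\<xi>s k \<in> borel_measurable (events_of {Sample k})"
    by (rule measurable_events_of; simp add: E_def)+
qed simp_all

lemma distr_past_present:
  assumes "Y \<in> measurable (events_of (past k)) S"
  shows "distr M S Y \<Otimes>\<^sub>M distr M (borel \<Otimes>\<^sub>M borel) (\<lambda>\<omega>. (z k \<omega>, \<xi>s k \<omega>))
    = distr M (S \<Otimes>\<^sub>M (borel \<Otimes>\<^sub>M borel)) (\<lambda>\<omega>. (Y \<omega>, (z k \<omega>, \<xi>s k \<omega>)))"
proof (rule distr_Pair_of_indep_set[OF _ _ _ assms])
  show "indep_set (sets (events_of (past k))) (sets (events_of {Perturb k, Sample k}))"
    unfolding events_of_def
    by (rule indep_set_sigma_collect[OF E_indep E_Int_stable]) (auto simp: past_def)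
  have "z k \<in> borel_measurable (events_of {Perturb k, Sample k})"
    "\<xi>s k \<in> borel_measurable (events_of {Perturb k, Sample k})"
    by (rule measurable_events_of[of _ "Perturb k"]; simp add: E_def)
       (rule measurable_events_of[of _ "Sample k"]; simp add: E_def)
  then show "(\<lambda>\<omega>. (z k \<omega>, \<xi>s k \<omega>)) \<in> measurable (events_of {Perturb k, Sample k}) (borel \<Otimes>\<^sub>M borel)"
    by simp
qed simp_all

lemma \<Phi>0_moment: "(\<integral>\<^sup>+\<omega>. ennreal ((norm (\<Phi>0 v (\<xi>s k \<omega>)))\<^sup>2) \<partial>M) \<le> ennreal (C\<^sup>2)"
proof (cases "v \<in> Xe")
  case True
  have "(\<integral>\<^sup>+\<omega>. ennreal ((norm (\<Phi>0 v (\<xi>s k \<omega>)))\<^sup>2) \<partial>M)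
      = (\<integral>\<^sup>+e. ennreal ((norm (\<Phi>0 v e))\<^sup>2) \<partial>distr M borel (\<xi>s k))"
    by (subst nn_integral_distr) auto
  also have "\<dots> = (\<integral>\<^sup>+\<omega>. ennreal ((norm (\<Phi>0 v (\<xi> \<omega>)))\<^sup>2) \<partial>M)"
    unfolding \<xi>s_copy by (subst nn_integral_distr) auto
  also have "\<dots> = ennreal (\<integral>\<omega>. (norm (\<Phi> v (\<xi> \<omega>)))\<^sup>2 \<partial>M)"
    using True moment_int[OF True] by (simp add: \<Phi>0_def nn_integral_eq_integral)
  also have "\<dots> \<le> ennreal (C\<^sup>2)" using moment[OF True] by (rule ennreal_leI)
  finally show ?thesis .
qed (simp add: \<Phi>0_def)

lemma \<Phi>0_integrable: "integrable M (\<lambda>\<omega>. \<Phi>0 v (\<xi>s k \<omega>))"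
  by (rule integrable_of_square) (auto intro: le_less_trans[OF \<Phi>0_moment])

lemma \<Phi>0_mean: "expectation (\<lambda>\<omega>. \<Phi>0 v (\<xi>s k \<omega>)) = F v"
proof (cases "v \<in> Xe")
  case True
  have "expectation (\<lambda>\<omega>. \<Phi>0 v (\<xi>s k \<omega>)) = (\<integral>e. \<Phi>0 v e \<partial>distr M borel (\<xi>s k))"
    by (subst integral_distr) auto
  also have "\<dots> = expectation (\<lambda>\<omega>. \<Phi>0 v (\<xi> \<omega>))"
    unfolding \<xi>s_copy by (subst integral_distr) auto
  also have "\<dots> = F v" using True by (simp add: \<Phi>0_def F mean_map_def)
  finally show ?thesis .
qed (simp add: \<Phi>0_def F_zero)

lemma \<Phi>0_shift_moment: "(\<integral>\<^sup>+\<omega>. ennreal ((norm (\<Phi>0 (v + z k \<omega>) (\<xi>s k \<omega>)))\<^sup>2) \<partial>M) \<le> ennreal (C\<^sup>2)"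
proof -
  have "(\<integral>\<^sup>+\<omega>. ennreal ((norm (\<Phi>0 (v + z k \<omega>) (\<xi>s k \<omega>)))\<^sup>2) \<partial>M)
      = (\<integral>\<^sup>+\<omega>. \<integral>\<^sup>+\<omega>'. ennreal ((norm (\<Phi>0 (v + z k \<omega>) (\<xi>s k \<omega>')))\<^sup>2) \<partial>M \<partial>M)"
    using nn_integral_resample[OF _ _ distr_sample_perturb, of k "\<lambda>p. ennreal ((norm (\<Phi>0 (v + fst p) (snd p)))\<^sup>2)"]
    by simp
  also have "\<dots> \<le> (\<integral>\<^sup>+\<omega>. ennreal (C\<^sup>2) \<partial>M)" by (intro nn_integral_mono \<Phi>0_moment)
  finally show ?thesis by (simp add: emeasure_space_1)
qed

lemma \<Phi>0_shift_integrable: "integrable M (\<lambda>\<omega>. \<Phi>0 (v + z k \<omega>) (\<xi>s k \<omega>))"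
  by (rule integrable_of_square) (auto intro: le_less_trans[OF \<Phi>0_shift_moment])

text \<open>First the sample is averaged at a fixed shift, giving \<open>F\<close>, then the shift,
  giving \<open>Fs k\<close>. The inner product with \<open>w\<close> makes the integrand real, as
  \<open>integral_resample\<close> requires.\<close>

lemma \<Phi>0_shift_mean: "expectation (\<lambda>\<omega>. \<Phi>0 (v + z k \<omega>) (\<xi>s k \<omega>) \<bullet> w) = Fs k v \<bullet> w"
proof -
  have "expectation (\<lambda>\<omega>. \<Phi>0 (v + z k \<omega>) (\<xi>s k \<omega>) \<bullet> w)
      = (\<integral>\<omega>. \<integral>\<omega>'. \<Phi>0 (v + z k \<omega>) (\<xi>s k \<omega>') \<bullet> w \<partial>M \<partial>M)"
    using integral_resample[OF _ _ distr_sample_perturb, of k "\<lambda>p. \<Phi>0 (v + fst p) (snd p) \<bullet> w"]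
      \<Phi>0_shift_integrable[of v k] by simp
  also have "\<dots> = expectation (\<lambda>\<omega>. F (v + z k \<omega>) \<bullet> w)"
    using \<Phi>0_integrable by (simp add: \<Phi>0_mean)
  also have "\<dots> = Fs k v \<bullet> w"
    using F_shift_integrable by (simp add: smoothed_map_def)
  finally show ?thesis .
qed

lemma g_moment:
  assumes A: "A \<in> sets (events_of (past k))"
  shows "(\<integral>\<^sup>+\<omega>. indicator A \<omega> * ennreal ((norm (g k \<omega>))\<^sup>2) \<partial>M) \<le> ennreal (C\<^sup>2 * prob A)"
proof -
  have AM [measurable]: "A \<in> events" using A events_of_subset by blast
  define Y :: "'w \<Rightarrow> 'a \<times> ennreal" where "Y \<omega> = (y k \<omega>, indicator A \<omega>)" for \<omega>
  have Y [measurable]: "Y \<in> measurable (events_of (past k)) (borel \<Otimes>\<^sub>M borel)"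
    unfolding Y_def using A y_measurable_past[of k k] by simp
  have [measurable]: "Y \<in> measurable M (borel \<Otimes>\<^sub>M borel)" unfolding Y_def by measurable
  define f :: "('a \<times> ennreal) \<times> ('a \<times> 'b) \<Rightarrow> ennreal" where
    "f p = snd (fst p) * ennreal ((norm (\<Phi>0 (fst (fst p) + fst (snd p)) (snd (snd p))))\<^sup>2)" for p
  have f [measurable]: "f \<in> borel_measurable ((borel \<Otimes>\<^sub>M borel) \<Otimes>\<^sub>M (borel \<Otimes>\<^sub>M borel))"
    unfolding f_def by measurable
  have "(\<integral>\<^sup>+\<omega>. indicator A \<omega> * ennreal ((norm (g k \<omega>))\<^sup>2) \<partial>M)
      = (\<integral>\<^sup>+\<omega>. f (Y \<omega>, (z k \<omega>, \<xi>s k \<omega>)) \<partial>M)"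
    by (simp add: f_def Y_def g_def)
  also have "\<dots> = (\<integral>\<^sup>+\<omega>. \<integral>\<^sup>+\<omega>'. f (Y \<omega>, (z k \<omega>', \<xi>s k \<omega>')) \<partial>M \<partial>M)"
    by (rule nn_integral_resample[OF _ _ distr_past_present[OF Y] f]) measurable
  also have "\<dots> = (\<integral>\<^sup>+\<omega>. indicator A \<omega> *
      (\<integral>\<^sup>+\<omega>'. ennreal ((norm (\<Phi>0 (y k \<omega> + z k \<omega>') (\<xi>s k \<omega>')))\<^sup>2) \<partial>M) \<partial>M)"
    by (simp add: f_def Y_def nn_integral_cmult)
  also have "\<dots> \<le> (\<integral>\<^sup>+\<omega>. indicator A \<omega> * ennreal (C\<^sup>2) \<partial>M)"
    by (intro nn_integral_mono mult_left_mono \<Phi>0_shift_moment) simp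
  also have "\<dots> = ennreal (C\<^sup>2 * prob A)"
    by (simp add: nn_integral_multc emeasure_eq_measure ennreal_mult mult.commute)
  finally show ?thesis .
qed

lemma g_square_integrable: "integrable M (\<lambda>\<omega>. (norm (g k \<omega>))\<^sup>2)" and g_integrable: "integrable M (g k)"
proof -
  have "space M \<in> sets (events_of (past k))" using sets.top[of "events_of (past k)"] by simp
  from g_moment[OF this]
  have "(\<integral>\<^sup>+\<omega>. indicator (space M) \<omega> * ennreal ((norm (g k \<omega>))\<^sup>2) \<partial>M) < \<infinity>"
    by (rule le_less_trans) simp
  also have "(\<integral>\<^sup>+\<omega>. indicator (space M) \<omega> * ennreal ((norm (g k \<omega>))\<^sup>2) \<partial>M)
      = (\<integral>\<^sup>+\<omega>. ennreal ((norm (g k \<omega>))\<^sup>2) \<partial>M)"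
    by (intro nn_integral_cong) simp
  finally show "integrable M (\<lambda>\<omega>. (norm (g k \<omega>))\<^sup>2)" "integrable M (g k)"
    using integrable_of_square[OF g_measurable] by auto
qed

lemma g_second_moment:
  assumes A: "A \<in> sets (events_of (past k))"
  shows "(\<integral>\<omega>. indicator A \<omega> * (norm (g k \<omega>))\<^sup>2 \<partial>M) \<le> C\<^sup>2 * prob A"
proof -
  have AM [measurable]: "A \<in> events" using A events_of_subset by blast
  have "ennreal (\<integral>\<omega>. indicator A \<omega> * (norm (g k \<omega>))\<^sup>2 \<partial>M)
      = (\<integral>\<^sup>+\<omega>. ennreal (indicator A \<omega> * (norm (g k \<omega>))\<^sup>2) \<partial>M)"
    using integrable_mult_indicator[OF AM g_square_integrable[of k]]
    by (intro nn_integral_eq_integral[symmetric]) auto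
  also have "\<dots> = (\<integral>\<^sup>+\<omega>. indicator A \<omega> * ennreal ((norm (g k \<omega>))\<^sup>2) \<partial>M)"
    by (intro nn_integral_cong) (auto simp: indicator_def)
  also have "\<dots> \<le> ennreal (C\<^sup>2 * prob A)" by (rule g_moment[OF A])
  finally show ?thesis by simp
qed

lemma integrable_bounded_on:
  fixes f :: "'w \<Rightarrow> real"
  assumes "f \<in> borel_measurable M" "A \<in> events" "\<And>\<omega>. \<omega> \<in> space M \<Longrightarrow> \<bar>f \<omega>\<bar> \<le> c"
  shows "integrable M (\<lambda>\<omega>. indicator A \<omega> * f \<omega>)"
proof -
  have "integrable M f" using assms by (intro integrable_const_bound[of _ c] AE_I2) auto
  from integrable_mult_indicator[OF assms(2) this] show ?thesis by simp
qed

lemma g_inner_integrable: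
  assumes A: "A \<in> events"
  shows "integrable M (\<lambda>\<omega>. indicator A \<omega> * (g k \<omega> \<bullet> (y k \<omega> - v)))"
proof -
  obtain R where R: "\<And>u. u \<in> X \<Longrightarrow> norm u \<le> R" using X_bound by blast
  have "integrable M (\<lambda>\<omega>. g k \<omega> \<bullet> (y k \<omega> - v))"
  proof (rule Bochner_Integration.integrable_bound)
    show "integrable M (\<lambda>\<omega>. (R + norm v) * norm (g k \<omega>))" using g_integrable[of k] by simp
    show "AE \<omega> in M. norm (g k \<omega> \<bullet> (y k \<omega> - v)) \<le> norm ((R + norm v) * norm (g k \<omega>))"
    proof (rule AE_I2)
      fix \<omega> assume "\<omega> \<in> space M"
      then have "norm (y k \<omega> - v) \<le> R + norm v"
        using R[OF y_mem] norm_triangle_ineq4[of "y k \<omega>" v] by (meson add_right_mono order_trans)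
      then have "\<bar>g k \<omega> \<bullet> (y k \<omega> - v)\<bar> \<le> norm (g k \<omega>) * (R + norm v)"
        by (meson Cauchy_Schwarz_ineq2 mult_left_mono norm_ge_zero order_trans)
      also have "\<dots> \<le> \<bar>(R + norm v) * norm (g k \<omega>)\<bar>" by (simp add: mult.commute)
      finally show "norm (g k \<omega> \<bullet> (y k \<omega> - v)) \<le> norm ((R + norm v) * norm (g k \<omega>))" by simp
    qed
  qed measurable
  from integrable_mult_indicator[OF A this] show ?thesis by simp
qed

lemma Fs_measurable [measurable]: "Fs k \<in> borel_measurable borel"
  unfolding smoothed_map_def by measurable

text \<open>The weak form of unbiasedness: given the past, \<open>g k\<close> has mean
  \<open>Fs k (y k)\<close>. It will be used with \<open>v = s k\<close>.\<close>

lemma g_inner_mean: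
  assumes A: "A \<in> sets (events_of (past k))"
  shows "(\<integral>\<omega>. indicator A \<omega> * (g k \<omega> \<bullet> (y k \<omega> - v)) \<partial>M)
    = (\<integral>\<omega>. indicator A \<omega> * (Fs k (y k \<omega>) \<bullet> (y k \<omega> - v)) \<partial>M)"
proof -
  have AM [measurable]: "A \<in> events" using A events_of_subset by blast
  define Y :: "'w \<Rightarrow> 'a \<times> real" where "Y \<omega> = (y k \<omega>, indicator A \<omega>)" for \<omega>
  have Y [measurable]: "Y \<in> measurable (events_of (past k)) (borel \<Otimes>\<^sub>M borel)"
    unfolding Y_def using A y_measurable_past[of k k] by simp
  have [measurable]: "Y \<in> measurable M (borel \<Otimes>\<^sub>M borel)" unfolding Y_def by measurable
  define f :: "('a \<times> real) \<times> ('a \<times> 'b) \<Rightarrow> real" where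
    "f p = snd (fst p) * (\<Phi>0 (fst (fst p) + fst (snd p)) (snd (snd p)) \<bullet> (fst (fst p) - v))" for p
  have f [measurable]: "f \<in> borel_measurable ((borel \<Otimes>\<^sub>M borel) \<Otimes>\<^sub>M (borel \<Otimes>\<^sub>M borel))"
    unfolding f_def by measurable
  have eq: "indicator A \<omega> * (g k \<omega> \<bullet> (y k \<omega> - v)) = f (Y \<omega>, (z k \<omega>, \<xi>s k \<omega>))" for \<omega>
    by (simp add: f_def Y_def g_def)
  have "(\<integral>\<omega>. f (Y \<omega>, (z k \<omega>, \<xi>s k \<omega>)) \<partial>M) = (\<integral>\<omega>. \<integral>\<omega>'. f (Y \<omega>, (z k \<omega>', \<xi>s k \<omega>')) \<partial>M \<partial>M)"
    by (rule integral_resample[OF _ _ distr_past_present[OF Y] f])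
       (use g_inner_integrable[OF AM, of k v] in \<open>simp_all add: eq\<close>)
  also have "\<dots> = (\<integral>\<omega>. indicator A \<omega> * (Fs k (y k \<omega>) \<bullet> (y k \<omega> - v)) \<partial>M)"
    by (simp add: f_def Y_def \<Phi>0_shift_mean)
  finally show ?thesis by (simp add: eq)
qed

subsection \<open>The recursion for the tracking error\<close>

text \<open>In the mean, \<open>g k\<close> may be replaced by the monotone
  \<open>Fs k (y k)\<close>. Together with the inequality solved by \<open>s k\<close>, the
  regularized direction then has inner product at least \<open>\<eta> k * D\<close> with the error;
  twice the step length gives the contraction. The factors 2 in the noise term come from separating
  \<open>g k\<close> and \<open>\<eta> k *\<^sub>R y k\<close> in the square.\<close>

lemma tracking_error_step:
  assumes A: "A \<in> sets (events_of (past k))" and R: "\<And>u. u \<in> X \<Longrightarrow> norm u \<le> R"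
  shows "(\<integral>\<omega>. indicator A \<omega> * (norm (y (Suc k) \<omega> - s k))\<^sup>2 \<partial>M)
    \<le> (1 - 2 * (\<gamma> k * \<eta> k)) * (\<integral>\<omega>. indicator A \<omega> * (norm (y k \<omega> - s k))\<^sup>2 \<partial>M)
      + (\<gamma> k)\<^sup>2 * (2 * C\<^sup>2 + 2 * (\<eta> k)\<^sup>2 * R\<^sup>2) * prob A"
proof -
  have AM [measurable]: "A \<in> events" using A events_of_subset by blast
  define D where "D \<omega> = (norm (y k \<omega> - s k))\<^sup>2" for \<omega>
  define P where "P \<omega> = g k \<omega> \<bullet> (y k \<omega> - s k)" for \<omega>
  define Q where "Q \<omega> = y k \<omega> \<bullet> (y k \<omega> - s k)" for \<omega>
  define N where "N \<omega> = (norm (g k \<omega>))\<^sup>2" for \<omega>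
  define S where "S \<omega> = Fs k (y k \<omega>) \<bullet> (y k \<omega> - s k)" for \<omega>
  note [measurable] = D_def P_def Q_def N_def S_def
  obtain B where B: "B > 0" "\<And>v. norm (F v) \<le> B" using F_bounded by blast
  have R0: "R \<ge> 0" using R[OF s_mem[of k]] norm_ge_zero order_trans by blast
  have diff: "norm (u - s k) \<le> 2 * R" if "u \<in> X" for u
    using norm_triangle_ineq4[of u "s k"] R[OF that] R[OF s_mem[of k]] by linarith
  have D_int: "integrable M (\<lambda>\<omega>. indicator A \<omega> * D \<omega>)"
    unfolding D_def
  proof (rule integrable_bounded_on)
    show "\<bar>(norm (y k \<omega> - s k))\<^sup>2\<bar> \<le> (2 * R)\<^sup>2" if "\<omega> \<in> space M" for \<omega>
      using power_mono[OF diff[OF y_mem[OF that]], of k 2] by simp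
  qed measurable
  have Q_int: "integrable M (\<lambda>\<omega>. indicator A \<omega> * Q \<omega>)"
    unfolding Q_def
  proof (rule integrable_bounded_on[of _ _ "R * (2 * R)"])
    fix \<omega> assume "\<omega> \<in> space M"
    then show "\<bar>y k \<omega> \<bullet> (y k \<omega> - s k)\<bar> \<le> R * (2 * R)"
      using R0 by (intro order_trans[OF Cauchy_Schwarz_ineq2] mult_mono R diff y_mem) auto
  qed measurable
  have S_int: "integrable M (\<lambda>\<omega>. indicator A \<omega> * S \<omega>)"
    unfolding S_def
  proof (rule integrable_bounded_on[of _ _ "B * (2 * R)"])
    have "norm (Fs k v) \<le> B" for v
      using norm_expectation_diff_le[OF F_shift_integrable[of v k], of "\<lambda>_. 0" B] B
      by (simp add: smoothed_map_def)
    then show "\<bar>Fs k (y k \<omega>) \<bullet> (y k \<omega> - s k)\<bar> \<le> B * (2 * R)" if "\<omega> \<in> space M" for \<omega>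
      using R0 B(1) that by (intro order_trans[OF Cauchy_Schwarz_ineq2] mult_mono diff y_mem) auto
  qed measurable
  have P_int: "integrable M (\<lambda>\<omega>. indicator A \<omega> * P \<omega>)"
    unfolding P_def by (rule g_inner_integrable[OF AM])
  have N_int: "integrable M (\<lambda>\<omega>. indicator A \<omega> * N \<omega>)"
    using integrable_mult_indicator[OF AM g_square_integrable[of k]] by (simp add: N_def)
  have A_int: "integrable M (indicator A :: 'w \<Rightarrow> real)"
    by (intro integrable_real_indicator) (auto simp: emeasure_eq_measure)
  \<comment> \<open>The integral of \<open>Q\<close> is kept on purpose: it cancels against the
    regularization term of the projected step.\<close>
  have drift: "\<eta> k * (\<integral>\<omega>. indicator A \<omega> * D \<omega> \<partial>M) - \<eta> k * (\<integral>\<omega>. indicator A \<omega> * Q \<omega> \<partial>M)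
      \<le> (\<integral>\<omega>. indicator A \<omega> * P \<omega> \<partial>M)"
  proof -
    have "\<eta> k * D \<omega> - \<eta> k * Q \<omega> \<le> S \<omega>" if "\<omega> \<in> space M" for \<omega>
    proof -
      have "(Fs k (y k \<omega>) - Fs k (s k)) \<bullet> (y k \<omega> - s k) \<ge> 0"
        using Fs_monotone y_mem[OF that] s_mem by (auto simp: monotone_map_on_def)
      moreover have "(Fs k (s k) + \<eta> k *\<^sub>R s k) \<bullet> (y k \<omega> - s k) \<ge> 0"
        by (rule s_ineq[OF y_mem[OF that]])
      ultimately show ?thesis
        unfolding D_def Q_def S_def power2_norm_eq_inner by (simp add: inner_simps algebra_simps)
    qed
    then have "(\<integral>\<omega>. \<eta> k * (indicator A \<omega> * D \<omega>) - \<eta> k * (indicator A \<omega> * Q \<omega>) \<partial>M)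
        \<le> (\<integral>\<omega>. indicator A \<omega> * S \<omega> \<partial>M)"
      using D_int Q_int S_int by (intro integral_mono) (auto simp: indicator_def)
    also have "\<dots> = (\<integral>\<omega>. indicator A \<omega> * P \<omega> \<partial>M)"
      unfolding S_def P_def by (rule g_inner_mean[OF A, symmetric])
    finally show ?thesis using D_int Q_int by simp
  qed
  have pointwise: "(norm (y (Suc k) \<omega> - s k))\<^sup>2
      \<le> D \<omega> - 2 * \<gamma> k * P \<omega> - 2 * \<gamma> k * \<eta> k * Q \<omega> + 2 * (\<gamma> k)\<^sup>2 * N \<omega> + 2 * (\<gamma> k)\<^sup>2 * (\<eta> k)\<^sup>2 * R\<^sup>2"
    if "\<omega> \<in> space M" for \<omega>
  proof -
    have "(norm (g k \<omega> + \<eta> k *\<^sub>R y k \<omega>))\<^sup>2 \<le> 2 * N \<omega> + 2 * (norm (\<eta> k *\<^sub>R y k \<omega>))\<^sup>2"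
      using norm_add_squared_le[of 1 "g k \<omega>" "\<eta> k *\<^sub>R y k \<omega>"] by (simp add: N_def)
    also have "(norm (\<eta> k *\<^sub>R y k \<omega>))\<^sup>2 \<le> (\<eta> k)\<^sup>2 * R\<^sup>2"
      using R[OF y_mem[OF that, of k]] by (simp add: power_mult_distrib mult_left_mono power_mono)
    finally have "(\<gamma> k)\<^sup>2 * (norm (g k \<omega> + \<eta> k *\<^sub>R y k \<omega>))\<^sup>2 \<le> (\<gamma> k)\<^sup>2 * (2 * N \<omega> + 2 * ((\<eta> k)\<^sup>2 * R\<^sup>2))"
      by (simp add: mult_left_mono)
    then show ?thesis
      using norm_diff_closest_point_step[OF X(2) X_closed s_mem[of k],
          of "y k \<omega>" "\<gamma> k" "g k \<omega> + \<eta> k *\<^sub>R y k \<omega>"]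
      by (simp add: D_def P_def Q_def g_def inner_add_left algebra_simps)
  qed
  have "(\<integral>\<omega>. indicator A \<omega> * (norm (y (Suc k) \<omega> - s k))\<^sup>2 \<partial>M)
      \<le> (\<integral>\<omega>. indicator A \<omega> * D \<omega> - 2 * \<gamma> k * (indicator A \<omega> * P \<omega>) - 2 * \<gamma> k * \<eta> k * (indicator A \<omega> * Q \<omega>)
        + 2 * (\<gamma> k)\<^sup>2 * (indicator A \<omega> * N \<omega>) + 2 * (\<gamma> k)\<^sup>2 * (\<eta> k)\<^sup>2 * R\<^sup>2 * indicator A \<omega> \<partial>M)"
  proof (rule integral_mono)
    show "integrable M (\<lambda>\<omega>. indicator A \<omega> * (norm (y (Suc k) \<omega> - s k))\<^sup>2)"
    proof (rule integrable_bounded_on)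
      show "\<bar>(norm (y (Suc k) \<omega> - s k))\<^sup>2\<bar> \<le> (2 * R)\<^sup>2" if "\<omega> \<in> space M" for \<omega>
        using power_mono[OF diff[OF y_mem[OF that]], of "Suc k" 2] by (simp del: y.simps)
    qed measurable
    show "indicator A \<omega> * (norm (y (Suc k) \<omega> - s k))\<^sup>2
      \<le> indicator A \<omega> * D \<omega> - 2 * \<gamma> k * (indicator A \<omega> * P \<omega>) - 2 * \<gamma> k * \<eta> k * (indicator A \<omega> * Q \<omega>)
        + 2 * (\<gamma> k)\<^sup>2 * (indicator A \<omega> * N \<omega>) + 2 * (\<gamma> k)\<^sup>2 * (\<eta> k)\<^sup>2 * R\<^sup>2 * indicator A \<omega>"
      if "\<omega> \<in> space M" for \<omega>
      using pointwise[OF that] by (auto simp: indicator_def)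
  qed (use D_int P_int Q_int N_int A_int in simp)
  also have "\<dots> = (\<integral>\<omega>. indicator A \<omega> * D \<omega> \<partial>M) - 2 * \<gamma> k * (\<integral>\<omega>. indicator A \<omega> * P \<omega> \<partial>M)
      - 2 * \<gamma> k * \<eta> k * (\<integral>\<omega>. indicator A \<omega> * Q \<omega> \<partial>M)
      + 2 * (\<gamma> k)\<^sup>2 * (\<integral>\<omega>. indicator A \<omega> * N \<omega> \<partial>M) + 2 * (\<gamma> k)\<^sup>2 * (\<eta> k)\<^sup>2 * R\<^sup>2 * prob A"
    using D_int P_int Q_int N_int A_int by simp
  also have "\<dots> \<le> (\<integral>\<omega>. indicator A \<omega> * D \<omega> \<partial>M)
      - 2 * \<gamma> k * (\<eta> k * (\<integral>\<omega>. indicator A \<omega> * D \<omega> \<partial>M) - \<eta> k * (\<integral>\<omega>. indicator A \<omega> * Q \<omega> \<partial>M))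
      - 2 * \<gamma> k * \<eta> k * (\<integral>\<omega>. indicator A \<omega> * Q \<omega> \<partial>M)
      + 2 * (\<gamma> k)\<^sup>2 * (C\<^sup>2 * prob A) + 2 * (\<gamma> k)\<^sup>2 * (\<eta> k)\<^sup>2 * R\<^sup>2 * prob A"
    using drift g_second_moment[OF A] \<gamma>_pos[of k] unfolding N_def
    by (intro add_mono diff_mono mult_left_mono order_refl) auto
  also have "\<dots> = (1 - 2 * (\<gamma> k * \<eta> k)) * (\<integral>\<omega>. indicator A \<omega> * D \<omega> \<partial>M)
      + (\<gamma> k)\<^sup>2 * (2 * C\<^sup>2 + 2 * (\<eta> k)\<^sup>2 * R\<^sup>2) * prob A"
    by (simp add: algebra_simps)
  finally show ?thesis unfolding D_def .
qed

text \<open>The target is moved first, by Young's inequality with weight \<open>u\<close>, and the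
  contraction \<open>1 - 2 * u\<close> is applied afterwards. \<open>2 * u \<le> 1\<close> keeps
  that factor nonnegative, and the uniform bound \<open>H\<close> leaves a fixed constant in front
  of the squared step.\<close>

lemma tracking_error_recursion:
  assumes A: "A \<in> sets (events_of (past (Suc k)))" and R: "\<And>u. u \<in> X \<Longrightarrow> norm u \<le> R"
    and H: "\<eta> (Suc k) \<le> H" and u: "u = \<gamma> (Suc k) * \<eta> (Suc k)" "2 * u \<le> 1"
  shows "(\<integral>\<omega>. indicator A \<omega> * (norm (y (Suc (Suc k)) \<omega> - s (Suc k)))\<^sup>2 \<partial>M)
    \<le> (1 - u) * (\<integral>\<omega>. indicator A \<omega> * (norm (y (Suc k) \<omega> - s k))\<^sup>2 \<partial>M)
      + ((norm (s (Suc k) - s k))\<^sup>2 / u + (\<gamma> (Suc k))\<^sup>2 * (2 * C\<^sup>2 + 2 * H\<^sup>2 * R\<^sup>2)) * prob A"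
proof -
  have AM [measurable]: "A \<in> events" using A events_of_subset by blast
  have u0: "u > 0" using u \<gamma>_pos \<eta>_pos by simp
  define d where "d = (norm (s (Suc k) - s k))\<^sup>2"
  define I where "I = (\<integral>\<omega>. indicator A \<omega> * (norm (y (Suc k) \<omega> - s k))\<^sup>2 \<partial>M)"
  have diff: "(norm (v - s j))\<^sup>2 \<le> (2 * R)\<^sup>2" if "v \<in> X" for v j
    using norm_triangle_ineq4[of v "s j"] R[OF that] R[OF s_mem[of j]] by (intro power_mono) auto
  have int: "integrable M (\<lambda>\<omega>. indicator A \<omega> * (norm (y (Suc k) \<omega> - s j))\<^sup>2)" for j
  proof (rule integrable_bounded_on)
    show "\<bar>(norm (y (Suc k) \<omega> - s j))\<^sup>2\<bar> \<le> (2 * R)\<^sup>2" if "\<omega> \<in> space M" for \<omega>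
      using diff[OF y_mem[OF that, of "Suc k"], of j] by (simp del: y.simps)
  qed measurable
  have A_int: "integrable M (indicator A :: 'w \<Rightarrow> real)"
    by (intro integrable_real_indicator) (auto simp: emeasure_eq_measure)
  have "(\<integral>\<omega>. indicator A \<omega> * (norm (y (Suc k) \<omega> - s (Suc k)))\<^sup>2 \<partial>M)
      \<le> (\<integral>\<omega>. (1 + u) * (indicator A \<omega> * (norm (y (Suc k) \<omega> - s k))\<^sup>2) + (1 + 1 / u) * d * indicator A \<omega> \<partial>M)"
  proof (rule integral_mono)
    show "indicator A \<omega> * (norm (y (Suc k) \<omega> - s (Suc k)))\<^sup>2
        \<le> (1 + u) * (indicator A \<omega> * (norm (y (Suc k) \<omega> - s k))\<^sup>2) + (1 + 1 / u) * d * indicator A \<omega>" for \<omega>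
      using norm_add_squared_le[OF u0, of "y (Suc k) \<omega> - s k" "s k - s (Suc k)"]
      by (auto simp: indicator_def d_def norm_minus_commute simp del: y.simps)
  qed (use int A_int in \<open>simp_all del: y.simps\<close>)
  also have "\<dots> = (1 + u) * I + (1 + 1 / u) * d * prob A"
    unfolding I_def using int A_int by (simp del: y.simps)
  finally have *: "(1 - 2 * u) * (\<integral>\<omega>. indicator A \<omega> * (norm (y (Suc k) \<omega> - s (Suc k)))\<^sup>2 \<partial>M)
      \<le> (1 - 2 * u) * ((1 + u) * I + (1 + 1 / u) * d * prob A)"
    using u(2) by (intro mult_left_mono) auto
  have I0: "I \<ge> 0" unfolding I_def by (intro integral_nonneg_AE AE_I2) (simp del: y.simps)
  have d0: "d * prob A \<ge> 0" by (simp add: d_def)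
  have 1: "(1 - 2 * u) * (1 + u) \<le> 1 - u" using u0 by (simp add: algebra_simps)
  have 2: "(1 - 2 * u) * (1 + 1 / u) \<le> 1 / u" using u0 by (simp add: field_simps)
  have "a * (b * I + c * d * prob A) = (a * b) * I + (a * c) * (d * prob A)" for a b c
    by (simp add: algebra_simps)
  then have "(1 - 2 * u) * ((1 + u) * I + (1 + 1 / u) * d * prob A)
      = ((1 - 2 * u) * (1 + u)) * I + ((1 - 2 * u) * (1 + 1 / u)) * (d * prob A)" .
  also have "\<dots> \<le> (1 - u) * I + (1 / u) * (d * prob A)"
    using 1 2 I0 d0 by (intro add_mono mult_right_mono)
  finally have 3: "(1 - 2 * u) * (\<integral>\<omega>. indicator A \<omega> * (norm (y (Suc k) \<omega> - s (Suc k)))\<^sup>2 \<partial>M)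
      \<le> (1 - u) * I + d / u * prob A" using * by simp
  have "(\<eta> (Suc k))\<^sup>2 \<le> H\<^sup>2" using H \<eta>_pos[of "Suc k"] by (intro power_mono) auto
  then have 4: "(\<gamma> (Suc k))\<^sup>2 * (2 * C\<^sup>2 + 2 * (\<eta> (Suc k))\<^sup>2 * R\<^sup>2) * prob A
      \<le> (\<gamma> (Suc k))\<^sup>2 * (2 * C\<^sup>2 + 2 * H\<^sup>2 * R\<^sup>2) * prob A"
    by (intro mult_right_mono mult_left_mono add_left_mono) auto
  have "(\<integral>\<omega>. indicator A \<omega> * (norm (y (Suc (Suc k)) \<omega> - s (Suc k)))\<^sup>2 \<partial>M)
      \<le> (1 - 2 * u) * (\<integral>\<omega>. indicator A \<omega> * (norm (y (Suc k) \<omega> - s (Suc k)))\<^sup>2 \<partial>M)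
        + (\<gamma> (Suc k))\<^sup>2 * (2 * C\<^sup>2 + 2 * (\<eta> (Suc k))\<^sup>2 * R\<^sup>2) * prob A"
    unfolding u(1) by (rule tracking_error_step[OF A R])
  with 3 4 show ?thesis
    unfolding d_def[symmetric] I_def[symmetric]
    by (simp only: distrib_right)
qed

lemma tracking_error_tendsto_zero: "AE \<omega> in M. (\<lambda>k. norm (x (Suc k) \<omega> - s k)) \<longlonglongrightarrow> 0"
proof -
  obtain R where R: "\<And>u. u \<in> X \<Longrightarrow> norm u \<le> R" using X_bound by blast
  obtain H where H: "\<And>k. \<eta> k \<le> H"
    using convergent_imp_Bseq[OF convergentI[OF \<eta>_lim]] unfolding Bseq_def
    by (metis abs_le_D1 real_norm_def)
  \<comment> \<open>The shift arises because passing from \<open>V k\<close> to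
    \<open>V (Suc k)\<close> uses step \<open>Suc k\<close> of the scheme.\<close>
  define u where "u k = \<gamma> (Suc k) * \<eta> (Suc k)" for k
  define K where "K = 2 * C\<^sup>2 + 2 * H\<^sup>2 * R\<^sup>2"
  define \<beta> where "\<beta> k = (norm (s (Suc k) - s k))\<^sup>2 / u k + (\<gamma> (Suc k))\<^sup>2 * K" for k
  define V where "V k \<omega> = (norm (y (Suc k) \<omega> - s k))\<^sup>2" for k \<omega>
  have u0: "u k > 0" for k using \<gamma>_pos \<eta>_pos by (simp add: u_def)
  have "(\<lambda>k. \<gamma> k * \<eta> k) \<longlonglongrightarrow> 0 * 0" by (intro tendsto_intros \<gamma>_lim \<eta>_lim)
  then have "u \<longlonglongrightarrow> 0" unfolding u_def by (subst filterlim_sequentially_Suc) simp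
  then have "\<forall>\<^sub>F k in sequentially. u k < 1 / 2" by (intro order_tendstoD) auto
  then obtain N where N: "\<And>k. k \<ge> N \<Longrightarrow> 2 * u k \<le> 1"
    unfolding eventually_sequentially by force
  have u_div: "filterlim (\<lambda>m. \<Sum>k<m. u k) at_top sequentially"
  proof -
    have "filterlim (\<lambda>m. - (\<gamma> 0 * \<eta> 0) + (\<Sum>k<Suc m. \<gamma> k * \<eta> k)) at_top sequentially"
      by (intro filterlim_tendsto_add_at_top[OF tendsto_const] filterlim_compose[OF step_div filterlim_Suc])
    then show ?thesis by (simp add: u_def sum.lessThan_Suc_shift del: sum.lessThan_Suc)
  qed
  have \<beta>_sum: "summable \<beta>"
    unfolding \<beta>_def u_def using \<gamma>_summable
    by (intro summable_add s_drift_summable summable_mult2) (simp add: summable_Suc_iff[of "\<lambda>k. (\<gamma> k)\<^sup>2"])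
  have "AE \<omega> in M. (\<lambda>k. V k \<omega>) \<longlonglongrightarrow> 0"
  \<comment> \<open>\<open>V k\<close> contains \<open>y (Suc k)\<close>, hence the filtration
    \<open>past (Suc k)\<close>.\<close>
  proof (rule AE_almost_supermartingale_tendsto_zero
      [of "\<lambda>k. events_of (past (Suc k))" V u \<beta> N])
    show "sets (events_of (past (Suc k))) \<subseteq> sets (events_of (past (Suc (Suc k))))" for k
      by (rule events_of_mono) (auto simp: past_def)
    show "V k \<in> borel_measurable (events_of (past (Suc k)))" for k
      unfolding V_def using y_measurable_past[of "Suc k" "Suc k"] by measurable
    show "integrable M (V k)" for k
    proof (rule integrable_const_bound[of _ "(2 * R)\<^sup>2"])
      show "AE \<omega> in M. norm (V k \<omega>) \<le> (2 * R)\<^sup>2"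
      proof (rule AE_I2)
        fix \<omega> assume "\<omega> \<in> space M"
        then have "norm (y (Suc k) \<omega> - s k) \<le> 2 * R"
          using norm_triangle_ineq4[of "y (Suc k) \<omega>" "s k"] R[OF y_mem[of \<omega> "Suc k"]] R[OF s_mem[of k]]
          by linarith
        then have "(norm (y (Suc k) \<omega> - s k))\<^sup>2 \<le> (2 * R)\<^sup>2" by (rule power_mono) (rule norm_ge_zero)
        then show "norm (V k \<omega>) \<le> (2 * R)\<^sup>2" unfolding V_def by (simp del: y.simps)
      qed
    qed (simp add: V_def[abs_def] del: y.simps)
    show "(\<integral>\<omega>. indicator A \<omega> * V (Suc k) \<omega> \<partial>M)
        \<le> (1 - u k) * (\<integral>\<omega>. indicator A \<omega> * V k \<omega> \<partial>M) + \<beta> k * prob A"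
      if "N \<le> k" "A \<in> sets (events_of (past (Suc k)))" for k A
      unfolding V_def \<beta>_def K_def
      by (rule tracking_error_recursion[OF that(2) R H u_def N[OF that(1)]])
    show "0 \<le> \<beta> k" for k using u0[of k] by (simp add: \<beta>_def K_def)
  qed (use u0 \<beta>_sum u_div events_of_subset in \<open>auto simp: V_def less_imp_le\<close>)
  with x_eq_y show ?thesis
  proof eventually_elim
    case (elim \<omega>)
    then have "(\<lambda>k. sqrt (V k \<omega>)) \<longlonglongrightarrow> sqrt 0" by (intro tendsto_real_sqrt)
    with elim show ?case by (simp add: V_def del: y.simps)
  qed
qed

section \<open>From the tracking error to the iterates\<close>

lemma accumulation_point_solution:
  assumes track: "(\<lambda>k. norm (x (Suc k) \<omega> - s k)) \<longlonglongrightarrow> 0"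
    and r: "strict_mono r" and lim: "(\<lambda>k. x (r k) \<omega>) \<longlonglongrightarrow> a"
  shows "a \<in> VI_solutions X F"
proof -
  \<comment> \<open>The iterate with index \<open>r k\<close> is tracked by \<open>s\<close> at the
    preceding index. Since \<open>r 0\<close> may be 0, the subsequence is started at
    \<open>r 1\<close>, where a predecessor exists.\<close>
  define q where "q k = r (Suc k) - 1" for k
  have q_Suc: "Suc (q k) = r (Suc k)" for k
    using strict_mono_imp_increasing[OF r, of "Suc k"] by (simp add: q_def)
  have "strict_mono q"
    using strict_monoD[OF r] q_Suc by (intro strict_monoI) (metis Suc_less_eq)
  then have q: "filterlim q at_top sequentially" by (rule filterlim_subseq)
  have "(\<lambda>k. x (Suc k) \<omega> - s k) \<longlonglongrightarrow> 0" using track by (rule tendsto_norm_zero_cancel)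
  from filterlim_compose[OF this q]
  have "(\<lambda>k. x (r (Suc k)) \<omega> - s (q k)) \<longlonglongrightarrow> 0" by (simp add: q_Suc)
  with LIMSEQ_Suc[OF lim]
  have "(\<lambda>k. x (r (Suc k)) \<omega> - (x (r (Suc k)) \<omega> - s (q k))) \<longlonglongrightarrow> a - 0" by (rule tendsto_diff)
  then have "(\<lambda>k. s (q k)) \<longlonglongrightarrow> a" by simp
  then show ?thesis by (rule s_limit_point[OF q])
qed

lemma iterates_tendsto:
  assumes track: "(\<lambda>k. norm (x (Suc k) \<omega> - s k)) \<longlonglongrightarrow> 0" and s_lim: "s \<longlonglongrightarrow> t"
  shows "(\<lambda>k. x k \<omega>) \<longlonglongrightarrow> t"
proof -
  have "(\<lambda>k. x (Suc k) \<omega> - s k) \<longlonglongrightarrow> 0" using track by (rule tendsto_norm_zero_cancel)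
  from tendsto_add[OF this s_lim] show ?thesis by (simp add: filterlim_sequentially_Suc[of "\<lambda>k. x k \<omega>"])
qed

end

theorem theorem1:
  fixes M :: "'w measure"
    and X Xe :: "(real ^ 'n) set"
    and \<Phi> :: "real ^ 'n \<Rightarrow> real ^ 'd \<Rightarrow> real ^ 'n"
    and F :: "real ^ 'n \<Rightarrow> real ^ 'n"
    and \<xi> :: "'w \<Rightarrow> real ^ 'd"
    and \<xi>s :: "nat \<Rightarrow> 'w \<Rightarrow> real ^ 'd"
    and z x :: "nat \<Rightarrow> 'w \<Rightarrow> real ^ 'n"
    and \<gamma> \<eta> \<epsilon>s :: "nat \<Rightarrow> real"
    and \<epsilon> C :: real
    and s :: "nat \<Rightarrow> real ^ 'n"
    and t :: "real ^ 'n"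
  assumes prob: "prob_space M"
    and X: "closed X" "bounded X" "convex X"
    and \<epsilon>: "\<epsilon> > 0"
    and Xe: "Xe = enlargement X \<epsilon>"
    and \<Phi>_meas: "case_prod \<Phi> \<in> borel_measurable (restrict_space borel Xe \<Otimes>\<^sub>M borel)"
    and \<xi>_rv: "\<xi> \<in> borel_measurable M"
    and F: "F = mean_map M \<xi> Xe \<Phi>"
    and F_mono: "monotone_map_on Xe F"
    and F_cont: "continuous_on Xe F"
    and C: "C > 0"
    and moment_int: "\<And>y. y \<in> Xe \<Longrightarrow> integrable M (\<lambda>\<omega>. (norm (\<Phi> y (\<xi> \<omega>)))\<^sup>2)"
    and moment: "\<And>y. y \<in> Xe \<Longrightarrow> (\<integral>\<omega>. (norm (\<Phi> y (\<xi> \<omega>)))\<^sup>2 \<partial>M) \<le> C\<^sup>2"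
    and solvable: "VI_solutions X F \<noteq> {}"
    and \<xi>s_rv: "\<And>k. \<xi>s k \<in> borel_measurable M"
    and \<xi>s_copy: "\<And>k. distr M borel (\<xi>s k) = distr M borel \<xi>"
    and z_rv: "\<And>k. z k \<in> borel_measurable M"
    and z_unif: "\<And>k. distr M borel (z k) = uniform_measure lborel (cball 0 (\<epsilon>s k))"
    and x0_rv: "x 0 \<in> borel_measurable M"
    and x0_in: "\<And>\<omega>. \<omega> \<in> space M \<Longrightarrow> x 0 \<omega> \<in> X"
    and x0_moment: "integrable M (\<lambda>\<omega>. (norm (x 0 \<omega>))\<^sup>2)"
    and indep: "mutually_independent M (x 0) \<xi>s z"
    and a: "\<And>k. \<gamma> k > 0" "\<And>k. \<eta> k > 0" "\<And>k. \<epsilon>s k > 0"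
           "\<gamma> \<longlonglongrightarrow> 0" "\<eta> \<longlonglongrightarrow> 0" "\<epsilon>s \<longlonglongrightarrow> 0"
    and b: "\<exists>K1::nat. \<forall>k\<ge>K1. \<gamma> k / (\<eta> k * (\<epsilon>s k)\<^sup>2) \<le>
              1 / 2 * (real (dfact (CARD('n) - 1)) /
                       (real (dfact CARD('n)) * kappa CARD('n) * C))\<^sup>2"
    and c: "\<And>k. \<epsilon>s k \<le> \<epsilon>"
    and d: "filterlim (\<lambda>m. \<Sum>k<m. \<gamma> k * \<eta> k) at_top sequentially"
    and e: "summable (\<lambda>k. (\<gamma> k)\<^sup>2)"
    and f: "summable (\<lambda>k. 1 / ((\<eta> k)\<^sup>2 * \<eta> (Suc k) * \<gamma> (Suc k)) *
              (1 - min (\<epsilon>s (Suc k)) (\<epsilon>s k) / max (\<epsilon>s (Suc k)) (\<epsilon>s k))\<^sup>2)"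
    and g: "summable (\<lambda>k. 1 / (\<eta> (Suc k) * \<gamma> (Suc k)) * (1 - \<eta> (Suc k) / \<eta> k)\<^sup>2)"
    and h: "(\<lambda>k. \<gamma> k / \<eta> k) \<longlonglongrightarrow> 0"
    and i: "(\<lambda>k. 1 / ((\<eta> (Suc k))\<^sup>2 * \<gamma> (Suc k)) *
              (1 - min (\<epsilon>s (Suc k)) (\<epsilon>s k) / max (\<epsilon>s (Suc k)) (\<epsilon>s k))) \<longlonglongrightarrow> 0"
    and j: "(\<lambda>k. 1 / (\<eta> (Suc k) * \<gamma> (Suc k)) * \<bar>1 - \<eta> (Suc k) / \<eta> k\<bar>) \<longlonglongrightarrow> 0"
    and scheme: "\<And>k \<omega>. \<omega> \<in> space M \<Longrightarrow>
          x (Suc k) \<omega> = closest_point X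
            (x k \<omega> - \<gamma> k *\<^sub>R (\<Phi> (x k \<omega> + z k \<omega>) (\<xi>s k \<omega>) + \<eta> k *\<^sub>R x k \<omega>))"
    and s: "\<And>k. s k = (THE y. y \<in> VI_solutions X (\<lambda>y. smoothed_map M (z k) F y + \<eta> k *\<^sub>R y))"
    and t: "t = (ARG_MIN norm y. y \<in> VI_solutions X F)"
  shows "(AE \<omega> in M.
            (\<lambda>k. norm (x (Suc k) \<omega> - s k)) \<longlonglongrightarrow> 0 \<and>
            (\<forall>r a. strict_mono (r :: nat \<Rightarrow> nat) \<and> (\<lambda>k. x (r k) \<omega>) \<longlonglongrightarrow> a
                   \<longrightarrow> a \<in> VI_solutions X F)) \<and>
         ((\<lambda>k. \<epsilon>s k / \<eta> k) \<longlonglongrightarrow> 0 \<and>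
          (\<exists>r>0. (\<forall>y\<in>ball t r. F differentiable (at y)) \<and>
                 bounded ((\<lambda>y. jacobian F (at y)) ` ball t r))
            \<longrightarrow> (AE \<omega> in M. (\<lambda>k. x k \<omega>) \<longlonglongrightarrow> t))"
proof -
  have X_compact: "compact X" using X(1,2) by (simp add: compact_eq_bounded_closed)
  have X_ne: "X \<noteq> {}" using solvable by (auto simp: VI_solutions_def)
  interpret prob_space M by (rule prob)
  interpret R: rssa M X Xe \<Phi> F \<xi> \<xi>s z x \<gamma> \<eta> \<epsilon>s \<epsilon> C s
    by unfold_locales (fact X_compact X_ne assms)+
  have X_Xe: "y \<in> Xe" if "y \<in> X" for y using R.X_sub_Xe[OF that] .
  have sol: "compact (VI_solutions X F)"
    using X_compact continuous_on_subset[OF F_cont] X_Xe by (intro compact_VI_solutions) auto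
  \<comment> \<open>Compactness and solvability turn the choice \<open>t\<close> into an actual
    minimizer of the norm.\<close>
  have t_sol: "t \<in> VI_solutions X F" "\<And>w. w \<in> VI_solutions X F \<Longrightarrow> norm t \<le> norm w"
    unfolding t by (rule arg_min_norm_mem[OF sol solvable])+
  show ?thesis
  proof (intro conjI impI)
    show "AE \<omega> in M. (\<lambda>k. norm (x (Suc k) \<omega> - s k)) \<longlonglongrightarrow> 0 \<and>
        (\<forall>r a. strict_mono (r :: nat \<Rightarrow> nat) \<and> (\<lambda>k. x (r k) \<omega>) \<longlonglongrightarrow> a \<longrightarrow> a \<in> VI_solutions X F)"
      using R.tracking_error_tendsto_zero
    proof eventually_elim
      case (elim \<omega>)
      then show ?case using R.accumulation_point_solution[OF elim] by blast
    qed
    assume *: "(\<lambda>k. \<epsilon>s k / \<eta> k) \<longlonglongrightarrow> 0 \<and>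
      (\<exists>r>0. (\<forall>y\<in>ball t r. F differentiable (at y)) \<and>
        bounded ((\<lambda>y. jacobian F (at y)) ` ball t r))"
    then obtain r where r: "r > 0" "\<And>y. y \<in> ball t r \<Longrightarrow> F differentiable (at y)"
      "bounded ((\<lambda>y. jacobian F (at y)) ` ball t r)" by blast
    obtain L where L: "L \<ge> 0"
      "\<And>y w. y \<in> ball t r \<Longrightarrow> w \<in> ball t r \<Longrightarrow> norm (F y - F w) \<le> L * norm (y - w)"
      using lipschitz_bound_of_bounded_jacobian[OF r(2,3)] by blast
    have s_lim: "s \<longlonglongrightarrow> t"
    proof (rule R.s_tendsto[OF _ t_sol r(1) _ L(1)])
      show "norm (F y - F t) \<le> L * norm (y - t)" if "y \<in> ball t r" for y
        using that r(1) by (intro L(2)) simp_all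
      show "(\<lambda>k. \<epsilon>s k / \<eta> k) \<longlonglongrightarrow> 0" using * by (rule conjunct1)
    qed
    show "AE \<omega> in M. (\<lambda>k. x k \<omega>) \<longlonglongrightarrow> t"
      using R.tracking_error_tendsto_zero by eventually_elim (rule R.iterates_tendsto[OF _ s_lim])
  qed
qed

end
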